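(* Let $\mathcal{A}$ be a unital complex algebra, let $\psi,\varphi:\mathcal{A}\to\mathbb{C}$ be unital linear functionals, and let $(\mathcal{A}_i)_{i\in I}$ be unital subalgebras of $\mathcal{A}$ that are conditionally free relatively to $(\psi,\varphi)$. Then the subalgebras $T(\mathcal{A}_i)$, $i\in I$, of the tensor algebra $T(\mathcal{A})$ are cyclically conditionally free relatively to the triple $(\psi,\varphi,[\varphi])$.
   Context: Tensor algebra: $T(\mathcal{A})=\mathbb{C}1\oplus\bigoplus_{n\ge1}\mathcal{A}^{\otimes n}$ with product $\otimes$; $T(\mathcal{A}_i)=\mathbb{C}1\oplus\bigoplus_{n\ge1}\mathcal{A}_i^{\otimes n}$. A linear functional $f$ on $\mathcal{A}$ is extended to $T(\mathcal{A})$ (same symbol) by $f(a_1\otimes\cdots\otimes a_n)=f(a_1\cdots a_n)$, $f(1)=f(1_{\mathcal{A}})$. A sequence $(a_1,\ldots,a_n)$ with $a_k$ in the $j_k$-th subalgebra is alternating if $j_k\ne j_{k+1}$ for $1\le k\le n-1$; it is cyclically alternating if $n\ge2$, it is alternating and moreover $j_n\ne j_1$. It is centered with respect to $\psi$ if $\psi(a_k)=0$ for all $k$. Conditional freeness: unital subalgebras $(\mathcal{B}_i)_{i\in I}$ are conditionally free relatively to $(\psi,\varphi)$ if for every alternating sequence $a_1,\ldots,a_n$ ($n\ge 1$) centered with respect to $\psi$, $\psi(a_1\cdots a_n)=0$ and $\varphi(a_1\cdots a_n)=\varphi(a_1)\cdots\varphi(a_n)$. Cyclic conditional freeness: unital subalgebras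 $(\mathcal{B}_i)_{i\in I}$ are cyclically conditionally free relatively to a triple $(\psi,\varphi,\omega)$, where $\psi,\varphi$ are unital linear functionals and $\omega$ is a tracial ($\omega(ab)=\omega(ba)$), possibly non-unital, linear functional, if they are conditionally free relatively to $(\psi,\varphi)$ and $\omega(a_1\cdots a_n)=\varphi(a_1)\cdots\varphi(a_n)$ for every cyclically alternating sequence $(a_1,\ldots,a_n)$ centered with respect to $\psi$. Boolean cumulants $\beta^\varphi$ are defined recursively by $\varphi(a_1\cdots a_n)=\sum_{I}\prod_{\{i,\ldots,j\}\in I}\beta^\varphi(a_i,\ldots,a_j)$, the sum over interval partitions $I$ of $\{1,\ldots,n\}$. The functional $[\varphi]$ on $T(\mathcal{A})$ is defined by $[\varphi](1)=1$ and $$[\varphi](a_1\otimes\cdots\otimes a_n)=\sum_{\ell=1}^n\ \sum_{1\le i_1<\cdots<i_\ell\le n}\ \prod_{k=1}^{\ell}\beta^\varphi(a_{i_k},a_{i_k+1},\ldots,a_{i_{k+1}-1}),$$ with $i_{\ell+1}=i_1$ and indices read cyclically modulo $n$ (the last factor is $\beta^\varphi(a_{i_\ell},\ldots,a_n,a_1,\ldots,a_{i_1-1})$). *)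

theory Defs
  imports Complex_Main "HOL-Library.Poly_Mapping" "HOL-Library.Disjoint_Sets"
begin

section \<open>Unital complex algebras\<close>

class complex_algebra_1 = ring_1 +
  fixes scaleC :: "complex \<Rightarrow> 'a \<Rightarrow> 'a"  (infixr \<open>*\<^sub>C\<close> 75)
  assumes scaleC_add_right: "c *\<^sub>C (x + y) = c *\<^sub>C x + c *\<^sub>C y"
    and scaleC_add_left: "(c + d) *\<^sub>C x = c *\<^sub>C x + d *\<^sub>C x"
    and scaleC_scaleC: "c *\<^sub>C d *\<^sub>C x = (c * d) *\<^sub>C x"
    and scaleC_one: "1 *\<^sub>C x = x"
    and mult_scaleC_left: "c *\<^sub>C x * y = c *\<^sub>C (x * y)"
    and mult_scaleC_right: "x * c *\<^sub>C y = c *\<^sub>C (x * y)"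

global_interpretation complex_vec: vector_space "scaleC :: complex \<Rightarrow> 'a \<Rightarrow> 'a::complex_algebra_1"
  by unfold_locales (simp_all add: scaleC_add_right scaleC_add_left scaleC_scaleC scaleC_one)

definition linear_functional :: "('a::complex_algebra_1 \<Rightarrow> complex) \<Rightarrow> bool" where
  "linear_functional f \<longleftrightarrow> Vector_Spaces.linear scaleC (*) f"

definition unital_functional :: "('a::complex_algebra_1 \<Rightarrow> complex) \<Rightarrow> bool" where
  "unital_functional f \<longleftrightarrow> linear_functional f \<and> f 1 = 1"

definition tracial :: "('a::complex_algebra_1 \<Rightarrow> complex) \<Rightarrow> bool" where
  "tracial f \<longleftrightarrow> (\<forall>a b. f (a * b) = f (b * a))"

definition unital_subalgebra :: "'a::complex_algebra_1 set \<Rightarrow> bool" where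
  "unital_subalgebra S \<longleftrightarrow> complex_vec.subspace S \<and> 1 \<in> S \<and> (\<forall>a\<in>S. \<forall>b\<in>S. a * b \<in> S)"

lemma linear_functional_iff:
  "linear_functional f \<longleftrightarrow> (\<forall>x y. f (x + y) = f x + f y) \<and> (\<forall>c x. f (c *\<^sub>C x) = c * f x)"
  unfolding linear_functional_def Vector_Spaces.linear_iff
  by (auto intro!: vector_space.intro simp: algebra_simps complex_vec.vector_space_axioms)

lemma linear_functional_zero: "linear_functional f \<Longrightarrow> f 0 = 0"
  unfolding linear_functional_iff by (metis add_cancel_right_right)


section \<open>Conditional freeness and cyclic conditional freeness\<close>

text \<open>The list \<open>js\<close> records which subalgebra each entry of \<open>as\<close> is taken from; the subalgebras
  overlap (they share the unit), so it is not determined by \<open>as\<close>.\<close>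

definition alternating ::
  "'i set \<Rightarrow> ('i \<Rightarrow> 'a set) \<Rightarrow> 'i list \<Rightarrow> 'a list \<Rightarrow> bool" where
  "alternating I B js as \<longleftrightarrow>
     list_all2 (\<lambda>j a. j \<in> I \<and> a \<in> B j) js as \<and> successively (\<noteq>) js"

definition cyclically_alternating ::
  "'i set \<Rightarrow> ('i \<Rightarrow> 'a set) \<Rightarrow> 'i list \<Rightarrow> 'a list \<Rightarrow> bool" where
  "cyclically_alternating I B js as \<longleftrightarrow>
     length as \<ge> 2 \<and> alternating I B js as \<and> last js \<noteq> hd js"

definition centered :: "('a \<Rightarrow> complex) \<Rightarrow> 'a list \<Rightarrow> bool" where
  "centered \<psi> as \<longleftrightarrow> (\<forall>a\<in>set as. \<psi> a = 0)"

definition conditionally_free ::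
  "('a::complex_algebra_1 \<Rightarrow> complex) \<Rightarrow> ('a \<Rightarrow> complex) \<Rightarrow> 'i set \<Rightarrow> ('i \<Rightarrow> 'a set) \<Rightarrow> bool" where
  "conditionally_free \<psi> \<phi> I B \<longleftrightarrow>
     (\<forall>i\<in>I. unital_subalgebra (B i)) \<and>
     (\<forall>js as. as \<noteq> [] \<and> alternating I B js as \<and> centered \<psi> as \<longrightarrow>
        \<psi> (prod_list as) = 0 \<and> \<phi> (prod_list as) = prod_list (map \<phi> as))"

definition cyclically_conditionally_free ::
  "('a::complex_algebra_1 \<Rightarrow> complex) \<Rightarrow> ('a \<Rightarrow> complex) \<Rightarrow> ('a \<Rightarrow> complex) \<Rightarrow>
     'i set \<Rightarrow> ('i \<Rightarrow> 'a set) \<Rightarrow> bool" where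
  "cyclically_conditionally_free \<psi> \<phi> \<omega> I B \<longleftrightarrow>
     unital_functional \<psi> \<and> unital_functional \<phi> \<and> linear_functional \<omega> \<and> tracial \<omega> \<and>
     conditionally_free \<psi> \<phi> I B \<and>
     (\<forall>js as. cyclically_alternating I B js as \<and> centered \<psi> as \<longrightarrow>
        \<omega> (prod_list as) = prod_list (map \<phi> as))"


section \<open>The tensor algebra\<close>

text \<open>Words over \<open>'a\<close> form the free monoid, so that the type \<open>'a list \<Rightarrow>\<^sub>0 complex\<close> is the free
  complex vector space on words, multiplied by concatenation.\<close>

instantiation list :: (type) monoid_add
begin
definition zero_list :: "'a list" where "zero_list = []"
definition plus_list :: "'a list \<Rightarrow> 'a list \<Rightarrow> 'a list" where "plus_list = (@)"
instance by standard (simp_all add: zero_list_def plus_list_def)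
end

text \<open>\<open>multilinear_null\<close> is the linear span of the relations expressing linearity in each slot. All
  words in a relation have the same length \<open>n\<close>, so the quotient by it is the direct sum over \<open>n\<close> of
  the quotients (free vector space on \<open>n\<close>-tuples)/(multilinearity), that is, of the tensor powers.
  Multiplication by \<open>single 0 c\<close> is scalar multiplication by \<open>c\<close>.\<close>

inductive_set multilinear_null :: "('a::complex_algebra_1 list \<Rightarrow>\<^sub>0 complex) set" where
  null_zero: "0 \<in> multilinear_null"
| null_plus: "p \<in> multilinear_null \<Longrightarrow> q \<in> multilinear_null \<Longrightarrow> p + q \<in> multilinear_null"
| null_scale: "p \<in> multilinear_null \<Longrightarrow> Poly_Mapping.single 0 c * p \<in> multilinear_null"
| null_slot_add: "k < length as \<Longrightarrow>
    Poly_Mapping.single (as[k := a + b]) 1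
      - (Poly_Mapping.single (as[k := a]) 1 + Poly_Mapping.single (as[k := b]) 1) \<in> multilinear_null"
| null_slot_scale: "k < length as \<Longrightarrow>
    Poly_Mapping.single (as[k := c *\<^sub>C a]) 1 - Poly_Mapping.single (as[k := a]) c \<in> multilinear_null"

definition tensor_rel ::
  "('a::complex_algebra_1 list \<Rightarrow>\<^sub>0 complex) \<Rightarrow> ('a list \<Rightarrow>\<^sub>0 complex) \<Rightarrow> bool" where
  "tensor_rel p q \<longleftrightarrow> p - q \<in> multilinear_null"

lemma null_uminus: "p \<in> multilinear_null \<Longrightarrow> - p \<in> multilinear_null"
proof -
  assume "p \<in> multilinear_null"
  then have "Poly_Mapping.single 0 (-1) * p \<in> multilinear_null" by (rule null_scale)
  then show ?thesis by (simp add: single_uminus)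
qed

lemma null_diff: "p \<in> multilinear_null \<Longrightarrow> q \<in> multilinear_null \<Longrightarrow> p - q \<in> multilinear_null"
  using null_plus[OF _ null_uminus] by fastforce

lemma single_0_commute: "Poly_Mapping.single 0 c * p = p * Poly_Mapping.single 0 (c::complex)"
  for p :: "'a list \<Rightarrow>\<^sub>0 complex"
proof (induction p rule: update_induct)
  case const
  then show ?case by simp
next
  case (update p a b)
  have "Poly_Mapping.update a b p = p + Poly_Mapping.single a b"
    using update by (intro poly_mapping_eqI)
      (auto simp: lookup_update lookup_add lookup_single when_def in_keys_iff)
  then show ?case using update by (simp add: algebra_simps mult_single)
qed

lemma free_induct [case_names zero add]:
  fixes p :: "'a list \<Rightarrow>\<^sub>0 complex"
  assumes "P 0" "\<And>p w c. P p \<Longrightarrow> P (p + Poly_Mapping.single w c)"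
  shows "P p"
proof (induction p rule: update_induct)
  case const
  then show ?case by (rule assms)
next
  case (update p a b)
  have "Poly_Mapping.update a b p = p + Poly_Mapping.single a b"
    using update by (intro poly_mapping_eqI)
      (auto simp: lookup_update lookup_add lookup_single when_def in_keys_iff)
  then show ?case using update assms by simp
qed

lemma null_single_mult: "p \<in> multilinear_null \<Longrightarrow> Poly_Mapping.single w c * p \<in> multilinear_null"
proof (induction rule: multilinear_null.induct)
  case null_zero
  then show ?case by (simp add: multilinear_null.null_zero)
next
  case (null_plus p q)
  then show ?case by (simp add: distrib_left multilinear_null.null_plus)
next
  case (null_scale p d)
  have "Poly_Mapping.single w c * (Poly_Mapping.single 0 d * p)
      = Poly_Mapping.single 0 d * (Poly_Mapping.single w c * p)"
    by (metis mult.assoc single_0_commute)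
  with null_scale show ?case by (simp add: multilinear_null.null_scale)
next
  case (null_slot_add k as a b)
  have *: "length w + k < length (w @ as)" using null_slot_add by simp
  show ?case
    using multilinear_null.null_scale[OF multilinear_null.null_slot_add[OF *], of c a b]
    by (simp add: distrib_left right_diff_distrib mult_single plus_list_def list_update_append zero_list_def)
next
  case (null_slot_scale k as d a)
  have *: "length w + k < length (w @ as)" using null_slot_scale by simp
  show ?case
    using multilinear_null.null_scale[OF multilinear_null.null_slot_scale[OF *], of c d a]
    by (simp add: distrib_left right_diff_distrib mult_single plus_list_def list_update_append zero_list_def)
qed

lemma null_mult_single: "p \<in> multilinear_null \<Longrightarrow> p * Poly_Mapping.single w c \<in> multilinear_null"
proof (induction rule: multilinear_null.induct)
  case null_zero
  then show ?case by (simp add: multilinear_null.null_zero)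
next
  case (null_plus p q)
  then show ?case by (simp add: distrib_right multilinear_null.null_plus)
next
  case (null_scale p d)
  then show ?case by (simp add: multilinear_null.null_scale mult.assoc)
next
  case (null_slot_add k as a b)
  then have *: "k < length (as @ w)" by simp
  show ?case
    using null_slot_add multilinear_null.null_scale[OF multilinear_null.null_slot_add[OF *], of c a b]
    by (simp add: distrib_left distrib_right left_diff_distrib right_diff_distrib mult_single
        plus_list_def list_update_append1 zero_list_def)
next
  case (null_slot_scale k as d a)
  then have *: "k < length (as @ w)" by simp
  show ?case
    using null_slot_scale multilinear_null.null_scale[OF multilinear_null.null_slot_scale[OF *], of c d a]
    by (simp add: distrib_left left_diff_distrib right_diff_distrib mult_single
        plus_list_def list_update_append1 zero_list_def mult.commute)
qed

lemma null_mult: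
  assumes "p \<in> multilinear_null"
  shows "q * p \<in> multilinear_null" "p * q \<in> multilinear_null"
proof -
  show "q * p \<in> multilinear_null"
    by (induction q rule: free_induct)
      (simp_all add: null_zero distrib_right null_plus null_single_mult[OF assms])
  show "p * q \<in> multilinear_null"
    by (induction q rule: free_induct)
      (simp_all add: null_zero distrib_left null_plus null_mult_single[OF assms])
qed

quotient_type (overloaded) 'a tensor_algebra =
  "'a::complex_algebra_1 list \<Rightarrow>\<^sub>0 complex" / tensor_rel
proof (rule equivpI)
  show "reflp (tensor_rel :: ('a list \<Rightarrow>\<^sub>0 complex) \<Rightarrow> _)"
    by (rule reflpI) (simp add: tensor_rel_def null_zero)
  show "symp (tensor_rel :: ('a list \<Rightarrow>\<^sub>0 complex) \<Rightarrow> _)"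
    by (rule sympI) (use null_uminus in \<open>force simp: tensor_rel_def\<close>)
  show "transp (tensor_rel :: ('a list \<Rightarrow>\<^sub>0 complex) \<Rightarrow> _)"
    by (rule transpI) (use null_plus in \<open>force simp: tensor_rel_def\<close>)
qed

text \<open>Linear extension to the free vector space.\<close>

definition free_extend :: "('a list \<Rightarrow> complex) \<Rightarrow> ('a list \<Rightarrow>\<^sub>0 complex) \<Rightarrow> complex" where
  "free_extend f p = (\<Sum>w\<in>Poly_Mapping.keys p. Poly_Mapping.lookup p w * f w)"

lemma free_extend_superset:
  "finite S \<Longrightarrow> Poly_Mapping.keys p \<subseteq> S \<Longrightarrow> free_extend f p = (\<Sum>w\<in>S. Poly_Mapping.lookup p w * f w)"
  unfolding free_extend_def by (rule sum.mono_neutral_left) (auto simp: in_keys_iff)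

lemma free_extend_add: "free_extend f (p + q) = free_extend f p + free_extend f q"
proof -
  let ?S = "Poly_Mapping.keys p \<union> Poly_Mapping.keys q"
  have "Poly_Mapping.keys (p + q) \<subseteq> ?S" by (rule keys_add)
  then show ?thesis
    by (simp add: free_extend_superset[of ?S] lookup_add distrib_right sum.distrib)
qed

lemma free_extend_single: "free_extend f (Poly_Mapping.single w c) = c * f w"
  by (simp add: free_extend_superset[of "{w}"])

lemma free_extend_zero: "free_extend f 0 = 0"
  by (simp add: free_extend_def)

lemma free_extend_diff: "free_extend f (p - q) = free_extend f p - free_extend f q"
  using free_extend_add[of f "p - q" q] by simp

lemma free_extend_scale: "free_extend f (Poly_Mapping.single 0 c * p) = c * free_extend f p"
  by (induction p rule: free_induct)
    (simp_all add: free_extend_zero free_extend_add distrib_left mult_single free_extend_single)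

text \<open>Functions of words of arbitrary length that are linear in each slot.\<close>

definition multilinear :: "('a::complex_algebra_1 list \<Rightarrow> complex) \<Rightarrow> bool" where
  "multilinear f \<longleftrightarrow> (\<forall>as k. k < length as \<longrightarrow> linear_functional (\<lambda>x. f (as[k := x])))"

lemma free_extend_null:
  assumes "multilinear f" "p \<in> multilinear_null"
  shows "free_extend f p = 0"
  using assms(2)
proof (induction rule: multilinear_null.induct)
  case (null_slot_add k as a b)
  then show ?case using assms(1)
    by (simp add: multilinear_def linear_functional_iff free_extend_diff free_extend_add free_extend_single)
next
  case (null_slot_scale k as c a)
  then show ?case using assms(1)
    by (simp add: multilinear_def linear_functional_iff free_extend_diff free_extend_add free_extend_single)
qed (simp_all add: free_extend_zero free_extend_add free_extend_scale)

instantiation tensor_algebra :: (complex_algebra_1) complex_algebra_1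
begin

lift_definition zero_tensor_algebra :: "'a tensor_algebra" is 0 .
lift_definition one_tensor_algebra :: "'a tensor_algebra" is 1 .
lift_definition plus_tensor_algebra :: "'a tensor_algebra \<Rightarrow> 'a tensor_algebra \<Rightarrow> 'a tensor_algebra"
  is "(+)"
  unfolding tensor_rel_def by (metis add_diff_add null_plus)
lift_definition uminus_tensor_algebra :: "'a tensor_algebra \<Rightarrow> 'a tensor_algebra" is uminus
  unfolding tensor_rel_def by (metis minus_diff_minus null_uminus)
lift_definition minus_tensor_algebra :: "'a tensor_algebra \<Rightarrow> 'a tensor_algebra \<Rightarrow> 'a tensor_algebra"
  is "(-)"
proof -
  fix p q r s :: "'a list \<Rightarrow>\<^sub>0 complex"
  assume "tensor_rel p q" "tensor_rel r s"
  then have "(p - q) - (r - s) \<in> multilinear_null"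
    unfolding tensor_rel_def by (rule null_diff)
  then show "tensor_rel (p - r) (q - s)"
    unfolding tensor_rel_def by (simp add: algebra_simps)
qed
lift_definition times_tensor_algebra :: "'a tensor_algebra \<Rightarrow> 'a tensor_algebra \<Rightarrow> 'a tensor_algebra"
  is "(*)"
proof -
  fix p q r s :: "'a list \<Rightarrow>\<^sub>0 complex"
  assume "tensor_rel p q" "tensor_rel r s"
  then have "p * (r - s) + (p - q) * s \<in> multilinear_null"
    unfolding tensor_rel_def by (intro null_plus null_mult)
  then show "tensor_rel (p * r) (q * s)"
    unfolding tensor_rel_def by (simp add: algebra_simps)
qed
lift_definition scaleC_tensor_algebra :: "complex \<Rightarrow> 'a tensor_algebra \<Rightarrow> 'a tensor_algebra"
  is "\<lambda>c p. Poly_Mapping.single 0 c * p"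
  unfolding tensor_rel_def by (metis null_scale right_diff_distrib)

lemma one_not_null: "(1 :: 'a list \<Rightarrow>\<^sub>0 complex) \<notin> multilinear_null"
proof
  assume *: "(1 :: 'a list \<Rightarrow>\<^sub>0 complex) \<in> multilinear_null"
  have "multilinear (\<lambda>as :: 'a list. if as = [] then 1 else 0)"
    by (auto simp: multilinear_def linear_functional_iff)
  from free_extend_null[OF this *] show False
    by (simp flip: single_one add: free_extend_single zero_list_def)
qed

instance
proof
  fix a b c :: "'a tensor_algebra" and x y :: complex
  have r: "tensor_rel p p" for p :: "'a list \<Rightarrow>\<^sub>0 complex"
    by (rule equivp_reflp[OF tensor_algebra_equivp])
  show "a + b + c = a + (b + c)" by transfer (simp add: add.assoc r)
  show "a + b = b + a" by transfer (simp add: add.commute r)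
  show "0 + a = a" by transfer (simp add: r)
  show "- a + a = 0" by transfer (simp add: r)
  show "a - b = a + - b" by transfer (simp add: r)
  show "a * b * c = a * (b * c)" by transfer (simp add: mult.assoc r)
  show "1 * a = a" by transfer (simp add: r)
  show "a * 1 = a" by transfer (simp add: r)
  show "(a + b) * c = a * c + b * c" by transfer (simp add: distrib_right r)
  show "a * (b + c) = a * b + a * c" by transfer (simp add: distrib_left r)
  show "(0 :: 'a tensor_algebra) \<noteq> 1"
    using one_not_null null_uminus[of "- 1 :: 'a list \<Rightarrow>\<^sub>0 complex"]
    by (auto simp: zero_tensor_algebra_def one_tensor_algebra_def tensor_algebra.abs_eq_iff tensor_rel_def)
  show "x *\<^sub>C (a + b) = x *\<^sub>C a + x *\<^sub>C b" by transfer (simp add: distrib_left r)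
  show "(x + y) *\<^sub>C a = x *\<^sub>C a + y *\<^sub>C a" by transfer (simp add: distrib_right single_add r)
  show "x *\<^sub>C y *\<^sub>C a = (x * y) *\<^sub>C a"
    by transfer (simp add: mult.assoc[symmetric] mult_single r)
  show "1 *\<^sub>C a = a" by transfer (simp add: r)
  show "x *\<^sub>C a * b = x *\<^sub>C (a * b)" by transfer (simp add: mult.assoc r)
  show "a * x *\<^sub>C b = x *\<^sub>C (a * b)"
  proof transfer
    fix p q :: "'a list \<Rightarrow>\<^sub>0 complex" and x
    show "tensor_rel (p * (Poly_Mapping.single 0 x * q)) (Poly_Mapping.single 0 x * (p * q))"
      by (simp add: mult.assoc[symmetric] single_0_commute[of x p] r)
  qed
qed

end

text \<open>\<open>pure_tensor [a\<^sub>1, \<dots>, a\<^sub>n]\<close> is \<open>a\<^sub>1 \<otimes> \<dots> \<otimes> a\<^sub>n\<close>. The unit of the tensor algebra is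
  \<open>pure_tensor []\<close>, which is different from \<open>pure_tensor [1]\<close>.\<close>

lift_definition pure_tensor :: "'a::complex_algebra_1 list \<Rightarrow> 'a tensor_algebra"
  is "\<lambda>as. Poly_Mapping.single as 1" .

lemma pure_tensor_Nil: "pure_tensor [] = 1"
  by transfer (simp add: equivp_reflp[OF tensor_algebra_equivp] flip: zero_list_def)

lemma pure_tensor_append: "pure_tensor (as @ bs) = pure_tensor as * pure_tensor bs"
  by transfer (simp add: equivp_reflp[OF tensor_algebra_equivp] mult_single plus_list_def)

lemma pure_tensor_add:
  "k < length as \<Longrightarrow> pure_tensor (as[k := a + b]) = pure_tensor (as[k := a]) + pure_tensor (as[k := b])"
  by transfer (simp add: tensor_rel_def null_slot_add)

lemma pure_tensor_scale:
  "k < length as \<Longrightarrow> pure_tensor (as[k := c *\<^sub>C a]) = c *\<^sub>C pure_tensor (as[k := a])"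
  by transfer (simp add: tensor_rel_def null_slot_scale mult_single)

lemma tensor_algebra_induct [case_names zero add]:
  assumes "P 0" "\<And>t c as. P t \<Longrightarrow> P (t + c *\<^sub>C pure_tensor as)"
  shows "P t"
proof -
  have "P (abs_tensor_algebra p)" for p :: "'a list \<Rightarrow>\<^sub>0 complex"
  proof (induction p rule: free_induct)
    case zero
    then show ?case using assms(1) by (simp add: zero_tensor_algebra_def)
  next
    case (add p w c)
    have "abs_tensor_algebra (p + Poly_Mapping.single w c)
        = abs_tensor_algebra p + c *\<^sub>C pure_tensor w"
      by (simp add: plus_tensor_algebra.abs_eq scaleC_tensor_algebra.abs_eq pure_tensor.abs_eq mult_single)
    with assms(2)[OF add] show ?case by simp
  qed
  then show ?thesis by (metis Quotient3_abs_rep[OF Quotient3_tensor_algebra])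
qed

text \<open>\<open>tensor_algebra_of S\<close> is \<open>T(S)\<close>, realised inside the tensor algebra of the ambient algebra.\<close>

definition tensor_algebra_of :: "'a::complex_algebra_1 set \<Rightarrow> 'a tensor_algebra set" where
  "tensor_algebra_of S = complex_vec.span {pure_tensor as |as. set as \<subseteq> S}"

text \<open>The linear functional on the tensor algebra with prescribed values \<open>f as\<close> on the pure tensors.
  It exists and is unique if \<open>f\<close> is multilinear.\<close>

definition tensor_lift :: "('a::complex_algebra_1 list \<Rightarrow> complex) \<Rightarrow> 'a tensor_algebra \<Rightarrow> complex" where
  "tensor_lift f = (THE F. linear_functional F \<and> (\<forall>as. F (pure_tensor as) = f as))"

lemma tensor_lift:
  assumes "multilinear f"
  shows "linear_functional (tensor_lift f)" "tensor_lift f (pure_tensor as) = f as"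
proof -
  define F where "F t = free_extend f (rep_tensor_algebra t)" for t
  have F: "F (abs_tensor_algebra p) = free_extend f p" for p
  proof -
    have "tensor_rel (rep_tensor_algebra (abs_tensor_algebra p)) p"
      by (rule Quotient3_rep_abs[OF Quotient3_tensor_algebra])
        (simp add: equivp_reflp[OF tensor_algebra_equivp])
    then show ?thesis
      using free_extend_null[OF assms] unfolding tensor_rel_def F_def
      by (fastforce simp: free_extend_diff)
  qed
  have "F (a + b) = F a + F b" "F (c *\<^sub>C a) = c * F a" for a b c
  proof -
    obtain p q where "a = abs_tensor_algebra p" "b = abs_tensor_algebra q"
      by (metis Quotient3_abs_rep[OF Quotient3_tensor_algebra])
    then show "F (a + b) = F a + F b" "F (c *\<^sub>C a) = c * F a"
      by (simp_all add: F plus_tensor_algebra.abs_eq scaleC_tensor_algebra.abs_eq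
          free_extend_add free_extend_scale)
  qed
  moreover have "F (pure_tensor as) = f as" for as
    by (simp add: pure_tensor.abs_eq F free_extend_single)
  ultimately have ex: "linear_functional F \<and> (\<forall>as. F (pure_tensor as) = f as)"
    by (simp add: linear_functional_iff)
  have "G = F" if "linear_functional G \<and> (\<forall>as. G (pure_tensor as) = f as)" for G
  proof
    fix t
    show "G t = F t"
    proof (induction t rule: tensor_algebra_induct)
      case zero
      show ?case using that ex linear_functional_zero[of G] linear_functional_zero[of F] by simp
    qed (use that ex in \<open>simp add: linear_functional_iff\<close>)
  qed
  with ex have "linear_functional (tensor_lift f) \<and> (\<forall>as. tensor_lift f (pure_tensor as) = f as)"
    unfolding tensor_lift_def by (rule theI)
  then show "linear_functional (tensor_lift f)" "tensor_lift f (pure_tensor as) = f as"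
    by auto
qed

text \<open>The extension of a functional on the algebra to its tensor algebra; for \<open>n = 0\<close> the product is
  the empty one, so that the unit is sent to \<open>f 1\<close>.\<close>

definition tensor_extension :: "('a::complex_algebra_1 \<Rightarrow> complex) \<Rightarrow> 'a tensor_algebra \<Rightarrow> complex" where
  "tensor_extension f = tensor_lift (\<lambda>as. f (prod_list as))"


section \<open>Boolean cumulants and the functional \<open>[\<phi>]\<close>\<close>

text \<open>Positions in a list are numbered from \<open>0\<close>, so \<open>{..<n}\<close> plays the role of \<open>{1, \<dots>, n}\<close>.\<close>

definition interval_partitions :: "nat \<Rightarrow> nat set set set" where
  "interval_partitions n = {P. partition_on {..<n} P \<and> (\<forall>B\<in>P. \<exists>i j. B = {i..<j})}"

lemma interval_partition_block_less:
  assumes "P \<in> interval_partitions n" "P \<noteq> {{..<n}}" "B \<in> P"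
  shows "B \<subset> {..<n}"
proof -
  have P: "\<Union>P = {..<n}" "disjoint P" "{} \<notin> P"
    using assms(1) by (auto simp: interval_partitions_def partition_on_def)
  have "B \<noteq> {..<n}"
  proof
    assume B: "B = {..<n}"
    have "C = B" if "C \<in> P" for C
    proof (rule ccontr)
      assume "C \<noteq> B"
      with P that assms(3) have "C \<inter> B = {}" by (auto simp: pairwise_def disjnt_def)
      moreover have "C \<subseteq> B" "C \<noteq> {}" using P that B by auto
      ultimately show False by auto
    qed
    with assms B show False by blast
  qed
  with assms(3) P show ?thesis by auto
qed

lemma finite_interval_partitions: "finite (interval_partitions n)"
  by (rule finite_subset[of _ "Pow (Pow {..<n})"])
    (auto simp: interval_partitions_def partition_on_def)

lemma interval_partitions_top: "n > 0 \<Longrightarrow> {{..<n}} \<in> interval_partitions n"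
  by (force simp: interval_partitions_def partition_on_def lessThan_atLeast0)

text \<open>The defining recursion, solved for the term of the one-block partition; the recursion in its
  usual form is \<open>boolean_cumulant_moment\<close> below. The value at the empty list is irrelevant.\<close>

function boolean_cumulant :: "('a::complex_algebra_1 \<Rightarrow> complex) \<Rightarrow> 'a list \<Rightarrow> complex" where
  "boolean_cumulant \<phi> as =
     \<phi> (prod_list as) -
     (\<Sum>P \<in> interval_partitions (length as) - {{{..<length as}}}. \<Prod>B\<in>P. boolean_cumulant \<phi> (nths as B))"
  by auto
termination
proof (relation "measure (\<lambda>(\<phi>, as). length as)", goal_cases)
  case 1
  show ?case by (rule wf_measure)
next
  case (2 \<phi> as P B)
  then have "P \<in> interval_partitions (length as)" "P \<noteq> {{..<length as}}" "B \<in> P"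
    by simp_all
  then have *: "B \<subset> {..<length as}" by (rule interval_partition_block_less)
  then have "{i. i < length as \<and> i \<in> B} = B" by auto
  with psubset_card_mono[OF _ *] show ?case by (simp add: length_nths)
qed

declare boolean_cumulant.simps [simp del]

lemma boolean_cumulant_moment:
  assumes "as \<noteq> []"
  shows "\<phi> (prod_list as) =
    (\<Sum>P\<in>interval_partitions (length as). \<Prod>B\<in>P. boolean_cumulant \<phi> (nths as B))"
proof -
  let ?\<beta> = "\<lambda>P. \<Prod>B\<in>P. boolean_cumulant \<phi> (nths as B)"
  let ?top = "{{..<length as}}"
  have "(\<Sum>P\<in>interval_partitions (length as). ?\<beta> P)
      = ?\<beta> ?top + (\<Sum>P\<in>interval_partitions (length as) - {?top}. ?\<beta> P)"
    using assms by (intro sum.remove finite_interval_partitions interval_partitions_top) simp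
  moreover have "?\<beta> ?top = boolean_cumulant \<phi> as"
    by (simp add: nths_all)
  moreover note boolean_cumulant.simps[of \<phi> as]
  ultimately show ?thesis by (simp only: add.commute[of _ "\<phi> (prod_list as) - _"] diff_add_cancel)
qed

text \<open>The list \<open>ks\<close> runs through \<open>i\<^sub>1 < \<dots> < i\<^sub>l\<close>. Appending \<open>i\<^sub>1 + n\<close> as \<open>i\<^sub>l\<^sub>+\<^sub>1\<close> and reading positions
  modulo \<open>n\<close> makes the last block wrap around.\<close>

definition cyclic_block :: "'a list \<Rightarrow> nat list \<Rightarrow> nat \<Rightarrow> 'a list" where
  "cyclic_block as ks k =
     (let js = ks @ [hd ks + length as]
      in map (\<lambda>m. as ! (m mod length as)) [js ! k ..< js ! Suc k])"

definition cyclic_value :: "('a::complex_algebra_1 \<Rightarrow> complex) \<Rightarrow> 'a list \<Rightarrow> complex" where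
  "cyclic_value \<phi> as =
     (if as = [] then 1
      else \<Sum>l = 1..length as.
           \<Sum>ks \<in> {ks. length ks = l \<and> sorted_wrt (<) ks \<and> set ks \<subseteq> {..<length as}}.
           \<Prod>k<l. boolean_cumulant \<phi> (cyclic_block as ks k))"

definition cyclic_functional :: "('a::complex_algebra_1 \<Rightarrow> complex) \<Rightarrow> 'a tensor_algebra \<Rightarrow> complex" where
  "cyclic_functional \<phi> = tensor_lift (cyclic_value \<phi>)"


section \<open>The two functionals on the tensor algebra are well defined\<close>

text \<open>The functions on words to which \<open>tensor_lift\<close> is applied above are multilinear.\<close>

lemma linear_functional_sum:
  "(\<And>i. i \<in> S \<Longrightarrow> linear_functional (f i)) \<Longrightarrow> linear_functional (\<lambda>x. \<Sum>i\<in>S. f i x)"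
  by (simp add: linear_functional_iff sum.distrib sum_distrib_left cong: sum.cong)

lemma linear_functional_diff:
  "linear_functional f \<Longrightarrow> linear_functional g \<Longrightarrow> linear_functional (\<lambda>x. f x - g x)"
  by (simp add: linear_functional_iff algebra_simps)

lemma linear_functional_read:
  assumes g: "\<And>bs q. length bs = length J \<Longrightarrow> q < length J \<Longrightarrow> linear_functional (\<lambda>x. g (bs[q := x]))"
    and J: "distinct J" "p \<in> set J" "p < length as" "set J \<subseteq> {..<length as}"
  shows "linear_functional (\<lambda>x. g (map ((!) (as[p := x])) J))"
proof -
  obtain q where q: "q < length J" "J ! q = p" using J(2) by (auto simp: in_set_conv_nth)
  have "map ((!) (as[p := x])) J = (map ((!) as) J)[q := x]" for x
    using q J by (intro nth_equalityI) (auto simp: nth_list_update nth_eq_iff_index_eq)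
  with g[of "map ((!) as) J" q] q show ?thesis by simp
qed

lemma linear_functional_prod_read:
  assumes "finite K" "k0 \<in> K" "p \<in> set (J k0)" "\<And>k. k \<in> K - {k0} \<Longrightarrow> p \<notin> set (J k)"
    and g: "\<And>bs q. length bs = length (J k0) \<Longrightarrow> q < length (J k0) \<Longrightarrow> linear_functional (\<lambda>x. g (bs[q := x]))"
    and J: "distinct (J k0)" "p < length as" "set (J k0) \<subseteq> {..<length as}"
  shows "linear_functional (\<lambda>x. \<Prod>k\<in>K. g (map ((!) (as[p := x])) (J k)))"
proof -
  have l: "linear_functional (\<lambda>x. g (map ((!) (as[p := x])) (J k0)))"
    by (rule linear_functional_read) (use assms in auto)
  have eq: "map ((!) (as[p := x])) (J k) = map ((!) as) (J k)" if "k \<in> K - {k0}" for k x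
    using assms(4)[OF that] by (auto intro!: nth_list_update_neq)
  have "(\<Prod>k\<in>K - {k0}. g (map ((!) (as[p := x])) (J k))) = (\<Prod>k\<in>K - {k0}. g (map ((!) as) (J k)))" for x
    by (rule prod.cong) (simp_all only: eq)
  then have "(\<Prod>k\<in>K. g (map ((!) (as[p := x])) (J k)))
      = g (map ((!) (as[p := x])) (J k0)) * (\<Prod>k\<in>K - {k0}. g (map ((!) as) (J k)))" for x
    using prod.remove[OF assms(1,2), of "\<lambda>k. g (map ((!) (as[p := x])) (J k))"] by simp
  with l show ?thesis by (simp add: linear_functional_iff algebra_simps)
qed

lemma linear_functional_prod_list:
  assumes "linear_functional f" "k < length as"
  shows "linear_functional (\<lambda>x. f (prod_list (as[k := x])))"
  using assms by (simp add: upd_conv_take_nth_drop linear_functional_iff distrib_left distrib_right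
      mult_scaleC_left mult_scaleC_right)

lemma multilinear_prod_list:
  "linear_functional f \<Longrightarrow> multilinear (\<lambda>as. f (prod_list as))"
  by (simp add: multilinear_def linear_functional_prod_list)

lemma nths_conv_map: "nths as B = map ((!) as) (filter (\<lambda>i. i \<in> B) [0..<length as])"
proof (induction as rule: rev_induct)
  case (snoc a as)
  have "filter (\<lambda>i. i \<in> B) [0..<length as] = filter (\<lambda>i. i \<in> B) [0..<length as]" ..
  then show ?case
    using snoc by (auto simp: nths_append nths_singleton nth_append)
qed simp

lemma multilinear_boolean_cumulant:
  assumes "linear_functional \<phi>"
  shows "multilinear (boolean_cumulant \<phi>)"
  unfolding multilinear_def
proof (intro allI impI)
  fix as :: "'a list" and p
  assume "p < length as"
  then show "linear_functional (\<lambda>x. boolean_cumulant \<phi> (as[p := x]))"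
  proof (induction "length as" arbitrary: as p rule: less_induct)
    case less
    let ?n = "length as"
    have "linear_functional (\<lambda>x. \<Prod>B\<in>P. boolean_cumulant \<phi> (nths (as[p := x]) B))"
      if "P \<in> interval_partitions ?n - {{{..<?n}}}" for P
    proof -
      have P: "\<Union>P = {..<?n}" "disjoint P"
        using that by (auto simp: interval_partitions_def partition_on_def)
      with less.prems obtain B where B: "B \<in> P" "p \<in> B" by blast
      define J where "J B = filter (\<lambda>i. i \<in> B) [0..<?n]" for B
      have "linear_functional (\<lambda>x. \<Prod>B\<in>P. boolean_cumulant \<phi> (map ((!) (as[p := x])) (J B)))"
      proof (rule linear_functional_prod_read[where ?k0.0 = B])
        have "P \<subseteq> Pow {..<?n}" using P by auto
        then show "finite P" by (rule finite_subset) simp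
        show "p \<notin> set (J C)" if "C \<in> P - {B}" for C
          using that B P(2) by (force simp: J_def pairwise_def disjnt_def)
        have "B \<subset> {..<?n}" using that B interval_partition_block_less[of P ?n B] by blast
        then have "card B < ?n" using psubset_card_mono[of "{..<?n}" B] by simp
        moreover have "length (J B) = card B"
          using \<open>B \<subset> {..<?n}\<close> unfolding J_def
          by (subst distinct_card[symmetric]) (auto intro!: arg_cong[where f = card])
        ultimately show "linear_functional (\<lambda>x. boolean_cumulant \<phi> (bs[q := x]))"
          if "length bs = length (J B)" "q < length (J B)" for bs q
          using that less.hyps[of bs q] by simp
      qed (use B less.prems in \<open>auto simp: J_def\<close>)
      then show ?thesis by (simp add: nths_conv_map J_def)
    qed
    then have "linear_functional (\<lambda>x. \<Sum>P\<in>interval_partitions ?n - {{{..<?n}}}.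
        \<Prod>B\<in>P. boolean_cumulant \<phi> (nths (as[p := x]) B))"
      by (rule linear_functional_sum)
    with linear_functional_prod_list[OF assms less.prems]
    have "linear_functional (\<lambda>x. \<phi> (prod_list (as[p := x])) -
        (\<Sum>P\<in>interval_partitions ?n - {{{..<?n}}}. \<Prod>B\<in>P. boolean_cumulant \<phi> (nths (as[p := x]) B)))"
      by (rule linear_functional_diff)
    moreover have "boolean_cumulant \<phi> (as[p := x]) = \<phi> (prod_list (as[p := x])) -
        (\<Sum>P\<in>interval_partitions ?n - {{{..<?n}}}. \<Prod>B\<in>P. boolean_cumulant \<phi> (nths (as[p := x]) B))" for x
      using boolean_cumulant.simps[of \<phi> "as[p := x]"] unfolding length_list_update .
    ultimately show ?case by (simp only:)
  qed
qed

lemma ex_step: "f 0 \<le> m \<Longrightarrow> m < f l \<Longrightarrow> \<exists>k<l. f k \<le> m \<and> m < f (Suc k)" for f :: "nat \<Rightarrow> nat"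
proof (induction l)
  case (Suc l)
  then show ?case by (cases "m < f l") (force simp: not_less less_Suc_eq)+
qed simp

lemma multilinear_cyclic_value:
  assumes "linear_functional \<phi>"
  shows "multilinear (cyclic_value \<phi>)"
proof -
  have "linear_functional (\<lambda>x. \<Prod>k<l. boolean_cumulant \<phi> (cyclic_block (as[p := x]) ks k))"
    if p: "p < length as" and l: "l \<ge> 1" and ks: "length ks = l" "sorted_wrt (<) ks" "set ks \<subseteq> {..<length as}"
    for as :: "'a list" and p l ks
  proof -
    let ?n = "length as"
    define js where "js = ks @ [hd ks + ?n]"
    define J where "J k = map (\<lambda>m. m mod ?n) [js ! k ..< js ! Suc k]" for k
    have "ks \<noteq> []" using l ks by auto
    then have "hd ks < ?n" using ks(3) hd_in_set by blast
    with \<open>ks \<noteq> []\<close> have js0: "js ! 0 = hd ks" "js ! l = js ! 0 + ?n" "length js = Suc l" "js ! 0 < ?n"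
      using ks by (auto simp: js_def nth_append hd_conv_nth)
    have "x < hd ks + ?n" if "x \<in> set ks" for x using ks that by fastforce
    then have sorted: "sorted_wrt (<) js"
      using ks by (simp add: js_def sorted_wrt_append)
    have mono: "js ! i \<le> js ! j" if "i \<le> j" "j \<le> l" for i j
      using that sorted_wrt_nth_less[OF sorted, of i j] js0 by (cases "i = j") auto
    have range: "js ! 0 \<le> m \<and> m < js ! 0 + ?n" if "k < l" "m \<in> {js ! k..<js ! Suc k}" for k m
      using that mono[of 0 k] mono[of "Suc k" l] js0 by auto
    define m where "m = (if js ! 0 \<le> p then p else p + ?n)"
    have m: "js ! 0 \<le> m" "m < js ! l" "m mod ?n = p" using p js0 by (auto simp: m_def)
    have uniq: "m' = m'' " if "m' mod ?n = m'' mod ?n" "js ! 0 \<le> m' \<and> m' < js ! 0 + ?n"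
      "js ! 0 \<le> m'' \<and> m'' < js ! 0 + ?n" for m' m''
    proof -
      have "inj_on (\<lambda>m. m mod ?n) {js ! 0..<js ! 0 + ?n}"
      proof (rule linorder_inj_onI)
        fix a b assume "a < b" "a \<in> {js ! 0..<js ! 0 + ?n}" "b \<in> {js ! 0..<js ! 0 + ?n}"
        then have "0 < b - a" "b - a < ?n" by auto
        then have "\<not> ?n dvd b - a" by (auto dest: dvd_imp_le)
        with \<open>a < b\<close> show "a mod ?n \<noteq> b mod ?n" by (metis less_imp_le mod_eq_dvd_iff_nat)
      qed auto
      with that show ?thesis by (auto dest: inj_onD)
    qed
    obtain k0 where k0: "k0 < l" "js ! k0 \<le> m" "m < js ! Suc k0"
      using ex_step[of "\<lambda>k. js ! k", OF m(1,2)] by blast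
    have "linear_functional (\<lambda>x. \<Prod>k<l. boolean_cumulant \<phi> (map ((!) (as[p := x])) (J k)))"
    proof (rule linear_functional_prod_read[where ?k0.0 = k0])
      show "k0 \<in> {..<l}" using k0 by simp
      show "p \<in> set (J k0)" using m k0 by (force simp: J_def)
      show "p \<notin> set (J k)" if k: "k \<in> {..<l} - {k0}" for k
      proof
        assume "p \<in> set (J k)"
        then obtain m' where m': "m' mod ?n = p" "m' \<in> {js ! k..<js ! Suc k}" by (auto simp: J_def)
        have "m' = m" using uniq[of m' m] range[of k m'] range[of k0 m] k k0 m m' by auto
        with m' k k0 mono[of "Suc k" k0] mono[of "Suc k0" k] show False
          by (cases "k < k0") (auto simp: not_less)
      qed
      show "distinct (J k0)"
        using range[OF k0(1)] uniq by (auto simp: J_def distinct_map inj_on_def)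
      show "linear_functional (\<lambda>x. boolean_cumulant \<phi> (bs[q := x]))"
        if "length bs = length (J k0)" "q < length (J k0)" for bs q
        using multilinear_boolean_cumulant[OF assms] that by (simp add: multilinear_def)
      show "set (J k0) \<subseteq> {..<?n}" using p by (auto simp: J_def intro!: mod_less_divisor)
    qed (use p in auto)
    then show ?thesis by (simp add: cyclic_block_def J_def js_def Let_def o_def)
  qed
  note block = this
  show ?thesis
    unfolding multilinear_def
  proof (intro allI impI)
    fix as :: "'a list" and p
    assume p: "p < length as"
    then have *: "as[p := x] \<noteq> []" for x by auto
    show "linear_functional (\<lambda>x. cyclic_value \<phi> (as[p := x]))"
      unfolding cyclic_value_def if_not_P[OF *] length_list_update
      by (intro linear_functional_sum block p) auto
  qed
qed

theorem tensor_extension: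
  assumes "linear_functional f"
  shows "linear_functional (tensor_extension f)"
    and "tensor_extension f (pure_tensor as) = f (prod_list as)"
  unfolding tensor_extension_def
  using tensor_lift[OF multilinear_prod_list[OF assms]] by auto

theorem cyclic_functional:
  assumes "linear_functional \<phi>"
  shows "linear_functional (cyclic_functional \<phi>)"
    and "cyclic_functional \<phi> (pure_tensor as) = cyclic_value \<phi> as"
  unfolding cyclic_functional_def
  using tensor_lift[OF multilinear_cyclic_value[OF assms]] by auto

end

theory Submission
  imports Defs
begin

text \<open>Sorting the cyclic interval partitions by the block containing the seam between \<open>a\<^sub>n\<close> and \<open>a\<^sub>1\<close> gives
  \<open>[\<phi>](a\<^sub>1 \<otimes> \<dots> \<otimes> a\<^sub>n) = \<phi>(a\<^sub>1 \<dots> a\<^sub>n) + \<Sum>\<beta>(r p) \<phi>(q)\<close>, summed over the factorisations \<open>p q r\<close> of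
  the word with \<open>p\<close> and \<open>r\<close> nonempty; \<open>r p\<close> is the block that wraps around. The first term already
  has the required values by conditional freeness, so the sum has to vanish on
  \<open>t\<^sub>1 \<otimes> \<dots> \<otimes> t\<^sub>n\<close> for cyclically alternating centered \<open>t\<^sub>k\<close>, which by linearity may be taken to be
  words minus their expectations. There each \<open>\<beta>(r p)\<close> has the form
  \<open>\<beta>(u \<otimes> t\<^sub>l\<^sub>+\<^sub>1 \<otimes> \<dots> \<otimes> t\<^sub>k\<^sub>-\<^sub>1 \<otimes> v)\<close> with nonempty words \<open>u\<close>, \<open>v\<close> such that the whole sequence is alternating.
  These values vanish by induction on the length: conditional freeness gives
  \<open>\<phi>(u t v) = \<phi>(u) \<phi>(t v)\<close>, and expanding the left side by its first block, the cuts inside \<open>u\<close>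
  alone sum to the right side.\<close>

section \<open>Sums over the factorisations of a word\<close>

text \<open>The sum of \<open>G p q\<close> over all factorisations \<open>x = p @ q\<close> with
  \<open>p\<close> nonempty; \<open>suffix_sum\<close> is its mirror image, with the right part
  nonempty. Recursion on the word makes concatenation and exchange laws plain inductions; the index
  form is recovered in \<open>prefix_sum_conv_sum\<close> and
  \<open>suffix_sum_conv_sum\<close>.\<close>

primrec prefix_sum :: "('a list \<Rightarrow> 'a list \<Rightarrow> complex) \<Rightarrow> 'a list \<Rightarrow> complex" where
  "prefix_sum G [] = 0"
| "prefix_sum G (a # x) = G [a] x + prefix_sum (\<lambda>p q. G (a # p) q) x"

primrec suffix_sum :: "('a list \<Rightarrow> 'a list \<Rightarrow> complex) \<Rightarrow> 'a list \<Rightarrow> complex" where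
  "suffix_sum G [] = 0"
| "suffix_sum G (a # x) = G [] (a # x) + suffix_sum (\<lambda>q r. G (a # q) r) x"

text \<open>A cut of \<open>x @ y\<close> falls in \<open>x\<close> or in \<open>y\<close>. The cut
  at the border is counted with \<open>x\<close> here and with \<open>y\<close> in
  \<open>suffix_sum_append\<close>, because of the part that has to be nonempty.\<close>

lemma prefix_sum_append:
  "prefix_sum G (x @ y) = prefix_sum (\<lambda>p q. G p (q @ y)) x + prefix_sum (\<lambda>p q. G (x @ p) q) y"
  by (induction x arbitrary: G) auto

lemma suffix_sum_append:
  "suffix_sum G (x @ y) = suffix_sum (\<lambda>q r. G q (r @ y)) x + suffix_sum (\<lambda>q r. G (x @ q) r) y"
  by (induction x arbitrary: G) auto

lemma prefix_sum_cong:
  "(\<And>p q. x = p @ q \<Longrightarrow> p \<noteq> [] \<Longrightarrow> G p q = H p q) \<Longrightarrow> prefix_sum G x = prefix_sum H x"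
proof (induction x arbitrary: G H)
  case (Cons a x)
  have "prefix_sum (\<lambda>p q. G (a # p) q) x = prefix_sum (\<lambda>p q. H (a # p) q) x"
    by (rule Cons.IH) (simp add: Cons.prems)
  then show ?case using Cons.prems[of "[a]" x] by simp
qed simp

lemma suffix_sum_cong:
  "(\<And>q r. x = q @ r \<Longrightarrow> r \<noteq> [] \<Longrightarrow> G q r = H q r) \<Longrightarrow> suffix_sum G x = suffix_sum H x"
proof (induction x arbitrary: G H)
  case (Cons a x)
  have "suffix_sum (\<lambda>q r. G (a # q) r) x = suffix_sum (\<lambda>q r. H (a # q) r) x"
    by (rule Cons.IH) (simp add: Cons.prems)
  then show ?case using Cons.prems[of "[]" "a # x"] by simp
qed simp

lemma prefix_sum_zero [simp]: "prefix_sum (\<lambda>p q. 0) x = 0"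
  by (induction x) auto

lemma suffix_sum_zero [simp]: "suffix_sum (\<lambda>q r. 0) x = 0"
  by (induction x) auto

lemma prefix_sum_add: "prefix_sum (\<lambda>p q. G p q + H p q) x = prefix_sum G x + prefix_sum H x"
  by (induction x arbitrary: G H) auto

lemma suffix_sum_add: "suffix_sum (\<lambda>q r. G q r + H q r) x = suffix_sum G x + suffix_sum H x"
  by (induction x arbitrary: G H) auto

lemma prefix_sum_diff: "prefix_sum (\<lambda>p q. G p q - H p q) x = prefix_sum G x - prefix_sum H x"
  by (induction x arbitrary: G H) auto

lemma suffix_sum_diff: "suffix_sum (\<lambda>q r. G q r - H q r) x = suffix_sum G x - suffix_sum H x"
  by (induction x arbitrary: G H) auto

lemma suffix_sum_mult_left: "suffix_sum (\<lambda>q r. c * G q r) x = c * suffix_sum G x"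
  by (induction x arbitrary: G) (auto simp: distrib_left)

lemma prefix_sum_mult_left: "prefix_sum (\<lambda>p q. c * G p q) x = c * prefix_sum G x"
  by (induction x arbitrary: G) (auto simp: distrib_left)

lemma prefix_sum_mult_right: "prefix_sum (\<lambda>p q. G p q * c) x = prefix_sum G x * c"
  by (induction x arbitrary: G) (auto simp: distrib_right)

lemma prefix_sum_top: "x \<noteq> [] \<Longrightarrow> prefix_sum (\<lambda>p q. if q = [] then H p else 0) x = H x"
proof (induction x arbitrary: H)
  case (Cons a x)
  then show ?case using Cons.IH[of "\<lambda>p. H (a # p)"] by (cases "x = []") auto
qed simp

lemma suffix_sum_top: "x \<noteq> [] \<Longrightarrow> suffix_sum (\<lambda>q r. if q = [] then H r else 0) x = H x"
  by (cases x) auto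

text \<open>Both sides run over the factorisations \<open>x = p @ q @ r\<close> with
  \<open>p\<close> and \<open>r\<close> nonempty.\<close>

lemma prefix_suffix_sum_assoc:
  "prefix_sum (\<lambda>p y. suffix_sum (\<lambda>q r. G p q r) y) x
     = suffix_sum (\<lambda>y r. prefix_sum (\<lambda>p q. G p q r) y) x"
  by (induction x arbitrary: G) (auto simp: suffix_sum_add)

lemma prefix_sum_conv_sum: "prefix_sum G x = (\<Sum>k=1..length x. G (take k x) (drop k x))"
proof (induction x arbitrary: G)
  case (Cons a x)
  have "(\<Sum>k=1..length (a # x). G (take k (a # x)) (drop k (a # x)))
      = (\<Sum>k=0..length x. G (a # take k x) (drop k x))"
    using sum.shift_bounds_cl_Suc_ivl[of "\<lambda>k. G (take k (a # x)) (drop k (a # x))" 0 "length x"] by simp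
  also have "\<dots> = G [a] x + (\<Sum>k=1..length x. G (a # take k x) (drop k x))"
    by (simp add: sum.atLeast_Suc_atMost)
  finally show ?case using Cons by simp
qed simp

lemma suffix_sum_conv_sum: "suffix_sum G x = (\<Sum>k<length x. G (take k x) (drop k x))"
proof (induction x arbitrary: G)
  case (Cons a x)
  show ?case unfolding list.size add_Suc_right add_0_right sum.lessThan_Suc_shift using Cons by simp
qed simp

section \<open>Products of centered words\<close>

lemma linear_functional_arith:
  assumes "linear_functional f"
  shows "f (x + y) = f x + f y" "f (x - y) = f x - f y" "f (c *\<^sub>C x) = c * f x"
proof -
  show add: "f (x + y) = f x + f y" for x y
    using assms by (simp add: linear_functional_iff)
  show "f (c *\<^sub>C x) = c * f x" using assms by (simp add: linear_functional_iff)
  show "f (x - y) = f x - f y" using add[of "x - y" y] by simp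
qed

text \<open>With weights \<open>g\<close>, this is the value of \<open>F\<close>, extended linearly, at the product of the
  elements \<open>w - g w \<cdot> 1\<close> of the free algebra on words.\<close>

primrec centered_sum ::
  "('a list \<Rightarrow> complex) \<Rightarrow> 'a list list \<Rightarrow> ('a list \<Rightarrow> complex) \<Rightarrow> complex" where
  "centered_sum g [] F = F []"
| "centered_sum g (w # ws) F = centered_sum g ws (\<lambda>x. F (w @ x)) - g w * centered_sum g ws F"

lemma centered_sum_zero [simp]: "centered_sum g ws (\<lambda>x. 0) = 0"
  by (induction ws) auto

lemma centered_sum_add:
  "centered_sum g ws (\<lambda>x. F x + H x) = centered_sum g ws F + centered_sum g ws H"
  by (induction ws arbitrary: F H) (auto simp: algebra_simps)

lemma centered_sum_diff:
  "centered_sum g ws (\<lambda>x. F x - H x) = centered_sum g ws F - centered_sum g ws H"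
  by (induction ws arbitrary: F H) (auto simp: right_diff_distrib)

lemma centered_sum_mult_left: "centered_sum g ws (\<lambda>x. c * F x) = c * centered_sum g ws F"
  by (induction ws arbitrary: F) (auto simp: algebra_simps)

lemma centered_sum_mult_right: "centered_sum g ws (\<lambda>x. F x * c) = centered_sum g ws F * c"
  by (induction ws arbitrary: F) (auto simp: algebra_simps)

lemma centered_sum_append:
  "centered_sum g (vs @ ws) F = centered_sum g vs (\<lambda>x. centered_sum g ws (\<lambda>y. F (x @ y)))"
  by (induction vs arbitrary: F) auto

lemma centered_sum_swap:
  "centered_sum g vs (\<lambda>x. centered_sum g ws (\<lambda>y. F x y))
     = centered_sum g ws (\<lambda>y. centered_sum g vs (\<lambda>x. F x y))"
  by (induction vs arbitrary: F) (auto simp: centered_sum_diff centered_sum_mult_left)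

lemma centered_sum_prefix_sum_swap:
  "centered_sum g ws (\<lambda>x. prefix_sum (\<lambda>p q. G x p q) y)
     = prefix_sum (\<lambda>p q. centered_sum g ws (\<lambda>x. G x p q)) y"
  by (induction y arbitrary: G) (auto simp: centered_sum_add)

lemma centered_sum_suffix_sum_swap:
  "centered_sum g ws (\<lambda>x. suffix_sum (\<lambda>q r. G x q r) y)
     = suffix_sum (\<lambda>q r. centered_sum g ws (\<lambda>x. G x q r)) y"
  by (induction y arbitrary: G) (auto simp: centered_sum_add)

text \<open>A cut of the concatenated word lies in exactly one of the words. The scalar part of that
  word has no cut, so only \<open>w = p @ q\<close> itself contributes there, while the words on
  both sides stay centered. The sum thus splits into the terms assumed to vanish.\<close>

lemma centered_sum_prefix_sum_eq_0:
  assumes "\<And>vs w us p q. ws = vs @ w # us \<Longrightarrow> w = p @ q \<Longrightarrow> p \<noteq> [] \<Longrightarrow>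
      centered_sum g vs (\<lambda>x. centered_sum g us (\<lambda>y. G (x @ p) (q @ y))) = 0"
  shows "centered_sum g ws (prefix_sum G) = 0"
  using assms
proof (induction ws arbitrary: G)
  case (Cons w ws)
  have "centered_sum g vs (\<lambda>x. centered_sum g us (\<lambda>y. G (w @ x @ p) (q @ y)))
      - g w * centered_sum g vs (\<lambda>x. centered_sum g us (\<lambda>y. G (x @ p) (q @ y))) = 0"
    if "ws = vs @ w' # us" "w' = p @ q" "p \<noteq> []" for vs w' us p q
    using Cons.prems[of "w # vs" w' us p q] that by simp
  \<comment> \<open>Cuts beyond \<open>w\<close>: the centered factor of \<open>w\<close> is
    absorbed into the first argument of \<open>G\<close>, and the induction hypothesis applies to
    this new function.\<close>
  then have *: "centered_sum g ws (prefix_sum (\<lambda>p q. G (w @ p) q - g w * G p q)) = 0"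
    by (intro Cons.IH) (simp add: centered_sum_diff centered_sum_mult_left)
  \<comment> \<open>Cuts inside \<open>w\<close>: here no word precedes the one being cut.\<close>
  have "prefix_sum (\<lambda>p q. centered_sum g ws (\<lambda>x. G p (q @ x))) w = prefix_sum (\<lambda>p q. 0) w"
    by (rule prefix_sum_cong) (use Cons.prems[of "[]" w ws] in simp)
  moreover have "prefix_sum (\<lambda>p q. G (w @ p) q - g w * G p q)
      = (\<lambda>x. prefix_sum (\<lambda>p q. G (w @ p) q) x - g w * prefix_sum G x)"
    by (simp add: fun_eq_iff prefix_sum_diff prefix_sum_mult_left)
  ultimately show ?case
    using * by (simp add: prefix_sum_append centered_sum_add centered_sum_prefix_sum_swap
        centered_sum_diff centered_sum_mult_left)
qed simp

lemma centered_sum_suffix_sum_eq_0: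
  assumes "\<And>vs w us q r. ws = vs @ w # us \<Longrightarrow> w = q @ r \<Longrightarrow> r \<noteq> [] \<Longrightarrow>
      centered_sum g vs (\<lambda>x. centered_sum g us (\<lambda>y. G (x @ q) (r @ y))) = 0"
  shows "centered_sum g ws (suffix_sum G) = 0"
  using assms
proof (induction ws arbitrary: G)
  case (Cons w ws)
  have "centered_sum g vs (\<lambda>x. centered_sum g us (\<lambda>y. G (w @ x @ q) (r @ y)))
      - g w * centered_sum g vs (\<lambda>x. centered_sum g us (\<lambda>y. G (x @ q) (r @ y))) = 0"
    if "ws = vs @ w' # us" "w' = q @ r" "r \<noteq> []" for vs w' us q r
    using Cons.prems[of "w # vs" w' us q r] that by simp
  then have *: "centered_sum g ws (suffix_sum (\<lambda>q r. G (w @ q) r - g w * G q r)) = 0"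
    by (intro Cons.IH) (simp add: centered_sum_diff centered_sum_mult_left)
  have "suffix_sum (\<lambda>q r. centered_sum g ws (\<lambda>x. G q (r @ x))) w = suffix_sum (\<lambda>q r. 0) w"
    by (rule suffix_sum_cong) (use Cons.prems[of "[]" w ws] in simp)
  moreover have "suffix_sum (\<lambda>q r. G (w @ q) r - g w * G q r)
      = (\<lambda>x. suffix_sum (\<lambda>q r. G (w @ q) r) x - g w * suffix_sum G x)"
    by (simp add: fun_eq_iff suffix_sum_diff suffix_sum_mult_left)
  ultimately show ?case
    using * by (simp add: suffix_sum_append centered_sum_add centered_sum_suffix_sum_swap
        centered_sum_diff centered_sum_mult_left)
qed simp

text \<open>The bridge from words to algebras. It serves for \<open>h = prod_list\<close>, to use
  conditional freeness in the given algebra, and for \<open>h = pure_tensor\<close>, to evaluate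
  functionals on the tensor algebra.\<close>

lemma centered_sum_hom:
  fixes h :: "'a list \<Rightarrow> 'b::complex_algebra_1"
  assumes h: "h [] = 1" "\<And>x y. h (x @ y) = h x * h y" and "linear_functional f"
  shows "centered_sum g ws (\<lambda>x. f (a * h x * b))
           = f (a * prod_list (map (\<lambda>w. h w - g w *\<^sub>C 1) ws) * b)"
proof (induction ws arbitrary: a)
  case (Cons w ws)
  show ?case
    using Cons[of "a * h w"] Cons[of a]
    by (simp add: h linear_functional_arith[OF assms(3)] mult.assoc algebra_simps
        mult_scaleC_left mult_scaleC_right)
qed (simp add: h)

section \<open>Moments and Boolean cumulants\<close>

lemma interval_partitions_0: "interval_partitions 0 = {{}}"
  by (auto simp: interval_partitions_def partition_on_def)

lemma shift_interval: "(+) k ` {i..<j} = {k + i..<k + j::nat}"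
  by (simp add: add.commute)

lemma inj_image_shift: "inj ((`) ((+) (k::nat)))"
proof (rule injI)
  fix B C assume "(+) k ` B = (+) k ` C"
  moreover have "inj ((+) k)" by simp
  ultimately show "B = C" by (metis inj_image_eq_iff)
qed

text \<open>Interval partitions of \<open>n > 0\<close> points correspond to pairs of the length
  \<open>k\<close> of the first block and an interval partition of the remaining
  \<open>n - k\<close> points. This lemma constructs a partition from a pair,
  \<open>interval_partition_first_block\<close> shows that every partition arises, and injectivity
  is part of \<open>sum_interval_partitions_first_block\<close>.\<close>

lemma insert_shift_interval_partition:
  assumes Q: "Q \<in> interval_partitions (n - k)" and k: "1 \<le> k" "k \<le> n"
  shows "insert {..<k} ((`) ((+) k) ` Q) \<in> interval_partitions n"
proof -
  have U: "\<Union>Q = {..<n - k}" and d: "disjoint Q" and e: "{} \<notin> Q"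
    and i: "\<forall>B\<in>Q. \<exists>i j. B = {i..<j}"
    using Q by (auto simp: interval_partitions_def partition_on_def)
  have "\<Union>((`) ((+) k) ` Q) = (+) k ` {..<n - k}" using U by blast
  also have "\<dots> = {k..<n}" using k unfolding lessThan_atLeast0 shift_interval by simp
  finally have S: "\<Union>((`) ((+) k) ` Q) = {k..<n}" .
  have "disjoint ((`) ((+) k) ` Q)"
    using d by (intro pairwiseI) (fastforce simp: pairwise_def disjnt_def)
  then have "disjoint (insert {..<k} ((`) ((+) k) ` Q))"
  proof (rule pairwise_insert[THEN iffD2, OF conjI, rotated])
    have "disjnt {..<k} B" if "B \<in> (`) ((+) k) ` Q" for B
      using that by (auto simp: disjnt_def)
    then show "\<forall>B. B \<in> (`) ((+) k) ` Q \<and> B \<noteq> {..<k} \<longrightarrow> disjnt {..<k} B \<and> disjnt B {..<k}"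
      by (simp add: disjnt_sym)
  qed
  moreover have "\<exists>i j. B = {i..<j}" if "B \<in> insert {..<k} ((`) ((+) k) ` Q)" for B
    using that i shift_interval by (metis imageE insertE lessThan_atLeast0)
  moreover have "{} \<notin> insert {..<k} ((`) ((+) k) ` Q)" 
  proof -
    have "0 \<in> {..<k}" using k by simp
    with e show ?thesis by blast
  qed
  moreover have "\<Union>(insert {..<k} ((`) ((+) k) ` Q)) = {..<n}" using S k by auto
  ultimately show ?thesis unfolding interval_partitions_def partition_on_def by blast
qed

lemma interval_partition_first_block:
  assumes P: "P \<in> interval_partitions n" and "n > 0"
  obtains k Q where "1 \<le> k" "k \<le> n" "Q \<in> interval_partitions (n - k)"
    "P = insert {..<k} ((`) ((+) k) ` Q)"
proof -
  have U: "\<Union>P = {..<n}" and d: "disjoint P" and e: "{} \<notin> P"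
    and i: "\<forall>B\<in>P. \<exists>i j. B = {i..<j}"
    using P by (auto simp: interval_partitions_def partition_on_def)
  have "0 \<in> \<Union>P" using U \<open>n > 0\<close> by simp
  then obtain B where B: "B \<in> P" "0 \<in> B" by blast
  then obtain k where k: "B = {..<k}" using i by (metis atLeastLessThan_iff lessThan_atLeast0 le_zero_eq)
  have "k \<ge> 1" using B k by auto
  have "k \<le> n" using B k U by (metis Union_upper lessThan_subset_iff)
  define Q where "Q = (`) (\<lambda>m. m - k) ` (P - {B})"
  \<comment> \<open>The other blocks miss \<open>{..<k}\<close>, so truncated subtraction of
    \<open>k\<close> is undone by the shift on them.\<close>
  have ge: "k \<le> m" if "C \<in> P - {B}" "m \<in> C" for C m
  proof -
    have "C \<inter> B = {}" using d B that by (auto simp: pairwise_def disjnt_def)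
    with that k show ?thesis by (auto simp: not_less[symmetric])
  qed
  have shift: "(+) k ` (\<lambda>m. m - k) ` C = C" if "C \<in> P - {B}" for C
    using ge[OF that] by (force simp: image_image)
  then have "(`) ((+) k) ` Q = P - {B}"
    unfolding Q_def by (auto simp: image_image)
  then have PQ: "P = insert {..<k} ((`) ((+) k) ` Q)" using B k by auto
  have "\<Union>(P - {B}) = {k..<n}"
  proof
    show "\<Union>(P - {B}) \<subseteq> {k..<n}" using ge U by fastforce
    show "{k..<n} \<subseteq> \<Union>(P - {B})"
    proof
      fix m assume m: "m \<in> {k..<n}"
      then have "m \<in> \<Union>P" using U by simp
      with m k show "m \<in> \<Union>(P - {B})" by auto
    qed
  qed
  then have "\<Union>Q = (\<lambda>m. m - k) ` {k..<n}" unfolding Q_def by blast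
  also have "\<dots> = {..<n - k}"
    using \<open>k \<le> n\<close> by (simp add: image_minus_const_atLeastLessThan_nat lessThan_atLeast0)
  finally have "\<Union>Q = {..<n - k}" .
  moreover have "{} \<notin> Q" using e by (auto simp: Q_def)
  moreover have "disjoint Q"
  proof (rule pairwiseI)
    fix C D assume "C \<in> Q" "D \<in> Q" "C \<noteq> D"
    then obtain C' D' where C': "C' \<in> P - {B}" "D' \<in> P - {B}" "C' \<noteq> D'"
      and CD: "C = (\<lambda>m. m - k) ` C'" "D = (\<lambda>m. m - k) ` D'" unfolding Q_def by blast
    then have "C' \<inter> D' = {}" using d by (auto simp: pairwise_def disjnt_def)
    moreover have "(+) k ` C = C'" "(+) k ` D = D'" using shift C' CD by auto
    ultimately show "disjnt C D" by (auto simp: disjnt_def)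
  qed
  moreover have "\<exists>i j. C = {i..<j}" if C: "C \<in> Q" for C
  proof -
    obtain C' where C': "C' \<in> P - {B}" "C = (\<lambda>m. m - k) ` C'" using C unfolding Q_def by blast
    then obtain i' j' where ij: "C' = {i'..<j'}" using i by blast
    have "C = {i' - k..<j' - k}"
    proof (cases "i' < j'")
      case True
      then have "k \<le> i'" using ge[OF C'(1), of i'] ij by simp
      with True show ?thesis unfolding C' ij
        by (simp add: image_minus_const_atLeastLessThan_nat)
    next
      case False
      then show ?thesis unfolding C' ij by simp
    qed
    then show ?thesis by blast
  qed
  ultimately have "Q \<in> interval_partitions (n - k)"
    by (simp add: interval_partitions_def partition_on_def)
  with \<open>k \<ge> 1\<close> \<open>k \<le> n\<close> show thesis using PQ by (rule that)
qed

lemma sum_interval_partitions_first_block: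
  fixes g :: "nat set \<Rightarrow> complex"
  assumes "n > 0"
  shows "(\<Sum>P\<in>interval_partitions n. \<Prod>B\<in>P. g B)
    = (\<Sum>k=1..n. g {..<k} * (\<Sum>Q\<in>interval_partitions (n - k). \<Prod>B\<in>Q. g ((+) k ` B)))"
proof -
  define S where "S = (SIGMA k:{1..n}. interval_partitions (n - k))"
  define h where "h = (\<lambda>(k, Q). insert {..<k} ((`) ((+) k) ` Q) :: nat set set)"
  have notin: "{..<k} \<notin> (`) ((+) k) ` Q" if "k \<ge> 1" for k :: nat and Q
  proof
    assume "{..<k} \<in> (`) ((+) k) ` Q"
    then obtain C where "{..<k} = (+) k ` C" by blast
    moreover have "0 \<in> {..<k}" using that by simp
    ultimately show False using that by auto
  qed
  have inj: "inj_on h S"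
  proof (rule inj_onI)
    fix a b assume ab: "a \<in> S" "b \<in> S" "h a = h b"
    obtain k Q where a: "a = (k, Q)" by (cases a)
    obtain l R where b: "b = (l, R)" by (cases b)
    have kl: "k \<ge> 1" "l \<ge> 1" using ab a b by (auto simp: S_def)
    \<comment> \<open>Shifted blocks do not contain 0, so the block of 0 determines
      \<open>k\<close>; removing it then determines \<open>Q\<close>.\<close>
    have first: "C = {..<k'}" if "C \<in> insert {..<k'} ((`) ((+) k') ` Q')" "0 \<in> C" "k' \<ge> 1"
      for C k' and Q' :: "nat set set"
    proof -
      have "0 \<notin> (+) k' ` D" for D using that(3) by (auto simp: image_iff)
      then show ?thesis using that by blast
    qed
    have hab: "insert {..<k} ((`) ((+) k) ` Q) = insert {..<l} ((`) ((+) l) ` R)"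
      using ab(3) by (simp only: a b h_def prod.case)
    moreover have "0 \<in> {..<k}" using kl by simp
    ultimately have "{..<k} = {..<l}" using first[of "{..<k}" l R] kl by blast
    then have "k = l" by simp
    have "(`) ((+) k) ` Q = insert {..<k} ((`) ((+) k) ` Q) - {{..<k}}"
      using notin[OF kl(1), of Q] by (rule Diff_insert_absorb[symmetric])
    also have "\<dots> = (`) ((+) k) ` R"
      unfolding hab unfolding \<open>k = l\<close>
      using notin[OF kl(2), of R] by (rule Diff_insert_absorb)
    finally have eq: "(`) ((+) k) ` Q = (`) ((+) k) ` R" .
    have "Q = R" using inj_image_eq_iff[OF inj_image_shift] eq by (rule iffD1)
    with \<open>k = l\<close> show "a = b" by (simp add: a b)
  qed
  have im: "h ` S = interval_partitions n"
  proof
    show "h ` S \<subseteq> interval_partitions n"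
      by (auto simp: S_def h_def intro: insert_shift_interval_partition)
    show "interval_partitions n \<subseteq> h ` S"
    proof
      fix P assume "P \<in> interval_partitions n"
      from interval_partition_first_block[OF this assms] obtain k Q
        where "1 \<le> k" "k \<le> n" "Q \<in> interval_partitions (n - k)"
          "P = insert {..<k} ((`) ((+) k) ` Q)" .
      then show "P \<in> h ` S" by (intro image_eqI[of _ _ "(k, Q)"]) (auto simp: S_def h_def)
    qed
  qed
  have fin: "finite Q" if "Q \<in> interval_partitions m" for Q m
    by (rule finite_subset[of _ "Pow {..<m}"]) (use that in \<open>auto simp: interval_partitions_def partition_on_def\<close>)
  have prod: "(\<Prod>B\<in>h (k, Q). g B) = g {..<k} * (\<Prod>B\<in>Q. g ((+) k ` B))"
    if "(k, Q) \<in> S" for k Q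
  proof -
    have "k \<ge> 1" "finite Q" using that fin by (auto simp: S_def)
    moreover have "inj_on ((`) ((+) k)) Q"
      using inj_image_shift by (rule inj_on_subset) simp
    ultimately show ?thesis using notin[of k Q] by (simp add: h_def prod.reindex)
  qed
  have "(\<Sum>P\<in>interval_partitions n. \<Prod>B\<in>P. g B) = (\<Sum>a\<in>S. \<Prod>B\<in>h a. g B)"
    using sum.reindex[OF inj, of "\<lambda>P. \<Prod>B\<in>P. g B"] by (simp add: im)
  also have "\<dots> = (\<Sum>(k, Q)\<in>S. g {..<k} * (\<Prod>B\<in>Q. g ((+) k ` B)))"
    by (rule sum.cong) (auto simp: prod)
  also have "\<dots> = (\<Sum>k=1..n. \<Sum>Q\<in>interval_partitions (n - k). g {..<k} * (\<Prod>B\<in>Q. g ((+) k ` B)))"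
    unfolding S_def by (rule sum.Sigma[symmetric]) (auto simp: finite_interval_partitions)
  finally show ?thesis by (simp add: sum_distrib_left)
qed

section \<open>Expansions of a moment by its first or its last block\<close>

lemma nths_shift: "nths as ((+) k ` B) = nths (drop k as) B"
proof (induction k arbitrary: as)
  case (Suc k)
  show ?case
  proof (cases as)
    case (Cons a as')
    have "{j. Suc j \<in> (+) (Suc k) ` B} = (+) k ` B" "0 \<notin> (+) (Suc k) ` B" by auto
    then show ?thesis using Suc[of as'] by (simp only: Cons nths_Cons drop_Suc_Cons) simp
  qed simp
qed simp

text \<open>Grouping the interval partitions by their first block \<open>p\<close>, the remaining
  blocks sum to the moment of the rest \<open>q\<close>.\<close>

lemma moment_eq_prefix_sum:
  assumes "\<phi> 1 = 1" "as \<noteq> []"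
  shows "\<phi> (prod_list as) = prefix_sum (\<lambda>p q. boolean_cumulant \<phi> p * \<phi> (prod_list q)) as"
proof -
  \<comment> \<open>The empty word has the empty partition alone, with product
    \<open>1 = \<phi> 1\<close>; this is the term in which the first block is the whole
    word.\<close>
  have "(\<Sum>Q\<in>interval_partitions (length bs). \<Prod>B\<in>Q. boolean_cumulant \<phi> (nths bs B)) = \<phi> (prod_list bs)" for bs
    using assms(1) boolean_cumulant_moment[of bs \<phi>] by (cases "bs = []") (auto simp: interval_partitions_0)
  from this[of "drop _ as"] show ?thesis
    using assms(2) by (simp add: boolean_cumulant_moment sum_interval_partitions_first_block
       nths_shift prefix_sum_conv_sum)
qed

text \<open>No second bijection of partitions is made: expand by the first block, expand the shorter
  rest by its last block using induction, exchange the two sums, and collect the first blocks again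
  into a moment.\<close>

lemma moment_eq_suffix_sum:
  assumes "\<phi> 1 = 1" "as \<noteq> []"
  shows "\<phi> (prod_list as) = suffix_sum (\<lambda>q r. \<phi> (prod_list q) * boolean_cumulant \<phi> r) as"
  using assms(2)
proof (induction "length as" arbitrary: as rule: less_induct)
  case less
  let ?\<beta> = "boolean_cumulant \<phi>" and ?m = "\<lambda>q. \<phi> (prod_list q)"
  let ?S = "suffix_sum (\<lambda>q r. ?m q * ?\<beta> r)" and ?P = "prefix_sum (\<lambda>p q. ?\<beta> p * ?m q)"
  have "?m as = ?P as" using assms(1) less.prems by (rule moment_eq_prefix_sum)
  \<comment> \<open>The term \<open>q = []\<close> is added separately, since \<open>?S []\<close>
    is 0 while the moment of the empty word is 1.\<close>
  also have "\<dots> = prefix_sum (\<lambda>p q. (if q = [] then ?\<beta> p else 0) + ?\<beta> p * ?S q) as"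
    by (rule prefix_sum_cong) (use less.hyps assms(1) in auto)
  also have "\<dots> = ?\<beta> as + prefix_sum (\<lambda>p q. suffix_sum (\<lambda>q r. ?\<beta> p * (?m q * ?\<beta> r)) q) as"
    using less.prems by (simp add: prefix_sum_add prefix_sum_top suffix_sum_mult_left)
  also have "prefix_sum (\<lambda>p q. suffix_sum (\<lambda>q r. ?\<beta> p * (?m q * ?\<beta> r)) q) as
      = suffix_sum (\<lambda>y r. ?P y * ?\<beta> r) as"
    by (simp add: prefix_suffix_sum_assoc prefix_sum_mult_right mult.assoc[symmetric])
  also have "?\<beta> as = suffix_sum (\<lambda>q r. if q = [] then ?\<beta> r else 0) as"
    using less.prems by (simp add: suffix_sum_top)
  also have "\<dots> + suffix_sum (\<lambda>y r. ?P y * ?\<beta> r) as = ?S as"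
    unfolding suffix_sum_add[symmetric]
    by (rule suffix_sum_cong) (use assms(1) moment_eq_prefix_sum[of \<phi>] in auto)
  finally show ?case .
qed

section \<open>Vanishing of cumulants under conditional freeness\<close>

lemma unital_subalgebra_prod_list:
  "unital_subalgebra S \<Longrightarrow> set w \<subseteq> S \<Longrightarrow> prod_list w \<in> S"
  by (induction w) (auto simp: unital_subalgebra_def)

lemma unital_subalgebra_center:
  "unital_subalgebra S \<Longrightarrow> a \<in> S \<Longrightarrow> a - c *\<^sub>C 1 \<in> S"
  by (simp add: unital_subalgebra_def complex_vec.subspace_diff complex_vec.subspace_scale)

text \<open>The empty sequence is included, so that the middle part \<open>cs\<close> in the next
  lemma may be empty.\<close>

lemma conditionally_free_prod_list:
  assumes "unital_functional \<phi>" "conditionally_free \<psi> \<phi> I B"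
    and "alternating I B js as" "centered \<psi> as"
  shows "\<phi> (prod_list as) = prod_list (map \<phi> as)"
  using assms by (cases "as = []") (auto simp: unital_functional_def conditionally_free_def)

text \<open>The end entries need not be centered: split each into a centered part and a multiple of
  the unit. In all four resulting products the remaining sequence is alternating and centered, so
  \<open>\<phi>\<close> multiplies, and \<open>\<phi> a' + \<psi> a = \<phi> a\<close> reassembles
  the first factor.\<close>

lemma conditionally_free_factor_first:
  assumes psi: "unital_functional \<psi>" and phi: "unital_functional \<phi>"
    and cf: "conditionally_free \<psi> \<phi> I B"
    and alt: "alternating I B (i # js @ [j]) (a # cs @ [b])" and cs: "centered \<psi> cs"
  shows "\<phi> (a * prod_list cs * b) = \<phi> a * \<phi> (prod_list cs * b)"
proof -
  define a' where "a' = a - \<psi> a *\<^sub>C 1"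
  define b' where "b' = b - \<psi> b *\<^sub>C 1"
  have len: "length js = length cs" using alt by (auto simp: alternating_def dest: list_all2_lengthD)
  then have mem: "i \<in> I" "a \<in> B i" "j \<in> I" "b \<in> B j" "list_all2 (\<lambda>j a. j \<in> I \<and> a \<in> B j) js cs"
    and suc: "successively (\<noteq>) (i # js @ [j])"
    using alt by (auto simp: alternating_def list_all2_append)
  then have sub: "unital_subalgebra (B i)" "unital_subalgebra (B j)"
    using cf by (auto simp: conditionally_free_def)
  have a'b': "a' \<in> B i" "b' \<in> B j"
    unfolding a'_def b'_def using sub mem by (auto intro: unital_subalgebra_center)
  have lin: "linear_functional \<psi>" "linear_functional \<phi>" "\<psi> 1 = 1" "\<phi> 1 = 1"
    using psi phi by (auto simp: unital_functional_def)
  note fl = linear_functional_arith[OF lin(1)] linear_functional_arith[OF lin(2)]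
  have cen: "centered \<psi> (a' # cs @ [b'])" "centered \<psi> (a' # cs)" "centered \<psi> (cs @ [b'])"
    using cs by (auto simp: centered_def a'_def b'_def fl lin)
  have "successively (\<noteq>) (i # js)" "successively (\<noteq>) (js @ [j])" "successively (\<noteq>) js"
    using suc by (auto simp: successively_append_iff successively_Cons)
  then have alts: "alternating I B (i # js @ [j]) (a' # cs @ [b'])" "alternating I B (i # js) (a' # cs)"
    "alternating I B (js @ [j]) (cs @ [b'])" "alternating I B js cs"
    using mem suc a'b' len by (auto simp: alternating_def list_all2_append)
  note pl = conditionally_free_prod_list[OF phi cf]
  define C where "C = prod_list (map \<phi> cs)"
  have vals: "\<phi> (a' * (prod_list cs * b')) = \<phi> a' * C * \<phi> b'" "\<phi> (a' * prod_list cs) = \<phi> a' * C"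
    "\<phi> (prod_list cs * b') = C * \<phi> b'" "\<phi> (prod_list cs) = C"
    using pl[OF alts(1) cen(1)] pl[OF alts(2) cen(2)] pl[OF alts(3) cen(3)] pl[OF alts(4) cs]
    by (simp_all add: C_def mult.assoc)
  have a: "a = a' + \<psi> a *\<^sub>C 1" and b: "b = b' + \<psi> b *\<^sub>C 1" by (simp_all add: a'_def b'_def)
  have bv: "\<phi> b' = \<phi> b - \<psi> b" by (simp add: b'_def fl lin)
  have c: "\<phi> (prod_list cs * b) = C * \<phi> b"
    by (subst b) (simp add: distrib_left mult_scaleC_right fl vals bv algebra_simps)
  have "\<phi> (a' * (prod_list cs * b)) = \<phi> a' * C * \<phi> b"
    by (subst b) (simp add: distrib_left mult_scaleC_right fl vals bv algebra_simps)
  then have "\<phi> ((a' + \<psi> a *\<^sub>C 1) * (prod_list cs * b)) = (\<phi> a' + \<psi> a) * (C * \<phi> b)"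
    by (simp add: distrib_right mult_scaleC_left fl c mult.assoc)
  then show ?thesis
    by (simp add: a[symmetric] c mult.assoc) (simp add: a'_def fl lin)
qed

text \<open>This is \<open>conditionally_free_factor_first\<close> for the products of the words:
  \<open>centered_sum_hom\<close> turns both centered sums into values of \<open>\<phi>\<close> at
  products with centered middle factors.\<close>

lemma centered_sum_moment_factor:
  assumes psi: "unital_functional \<psi>" and phi: "unital_functional \<phi>"
    and cf: "conditionally_free \<psi> \<phi> I A"
    and alt: "alternating I (\<lambda>j. lists (A j)) (i # js @ [j]) (u # ws @ [v])"
  shows "centered_sum (\<lambda>w. \<psi> (prod_list w)) ws (\<lambda>x. \<phi> (prod_list (u @ x @ v)))
    = \<phi> (prod_list u) * centered_sum (\<lambda>w. \<psi> (prod_list w)) ws (\<lambda>x. \<phi> (prod_list (x @ v)))"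
proof -
  let ?c = "\<lambda>w. prod_list w - \<psi> (prod_list w) *\<^sub>C 1"
  have lin: "linear_functional \<psi>" "linear_functional \<phi>" "\<psi> 1 = 1"
    using psi phi by (auto simp: unital_functional_def)
  have sub: "unital_subalgebra (A k)" if "k \<in> I" for k
    using cf that by (simp add: conditionally_free_def)
  have len: "length js = length ws"
    using alt by (auto simp: alternating_def dest: list_all2_lengthD)
  have "list_all2 (\<lambda>j a. j \<in> I \<and> a \<in> A j) (i # js @ [j]) (map prod_list (u # ws @ [v]))"
    using alt unfolding alternating_def list_all2_map2
    by (auto intro!: unital_subalgebra_prod_list sub elim!: list_all2_mono)
  moreover have "list_all2 (\<lambda>j a. j \<in> I \<and> a \<in> A j) js (map ?c ws)"
  proof -
    have "list_all2 (\<lambda>j w. j \<in> I \<and> w \<in> lists (A j)) js ws"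
      using alt len by (auto simp: alternating_def list_all2_append)
    then show ?thesis unfolding list_all2_map2
      by (auto intro!: unital_subalgebra_center unital_subalgebra_prod_list sub elim!: list_all2_mono)
  qed
  ultimately have "alternating I A (i # js @ [j]) (prod_list u # map ?c ws @ [prod_list v])"
    using alt len by (auto simp: alternating_def list_all2_append)
  moreover have "centered \<psi> (map ?c ws)"
    using lin by (auto simp: centered_def linear_functional_arith[OF lin(1)])
  ultimately have "\<phi> (prod_list u * prod_list (map ?c ws) * prod_list v)
      = \<phi> (prod_list u) * \<phi> (prod_list (map ?c ws) * prod_list v)"
    by (rule conditionally_free_factor_first[OF psi phi cf])
  moreover note
    centered_sum_hom[of prod_list \<phi> "\<lambda>w. \<psi> (prod_list w)" ws "prod_list u" "prod_list v"]
    centered_sum_hom[of prod_list \<phi> "\<lambda>w. \<psi> (prod_list w)" ws 1 "prod_list v"]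
  ultimately show ?thesis using lin by (simp add: mult.assoc)
qed

lemma alternating_split:
  assumes "alternating I B js (vs @ w # us)"
  obtains js1 k js2 where "js = js1 @ k # js2" "length js1 = length vs" "k \<in> I" "w \<in> B k"
    "list_all2 (\<lambda>j a. j \<in> I \<and> a \<in> B j) js1 vs" "list_all2 (\<lambda>j a. j \<in> I \<and> a \<in> B j) js2 us"
  using assms by (auto simp: alternating_def list_all2_append2 list_all2_Cons2)

text \<open>Ending the first block inside a word of \<open>ws\<close>, or properly inside
  \<open>v\<close>, leaves an instance with the same \<open>u\<close> and a shorter tail; hence the
  induction on the length of \<open>concat ws @ v\<close>. The indices \<open>i\<close> and
  \<open>j\<close> may coincide when \<open>ws\<close> is nonempty, which covers a wrapping block
  with both ends in one word.\<close>

lemma boolean_cumulant_centered_eq_0: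
  assumes psi: "unital_functional \<psi>" and phi: "unital_functional \<phi>"
    and cf: "conditionally_free \<psi> \<phi> I A"
    and "alternating I (\<lambda>j. lists (A j)) (i # js @ [j]) (u # ws @ [v])" "u \<noteq> []" "v \<noteq> []"
  shows "centered_sum (\<lambda>w. \<psi> (prod_list w)) ws (\<lambda>x. boolean_cumulant \<phi> (u @ x @ v)) = 0"
  using assms(4-6)
proof (induction "length (concat ws @ v)" arbitrary: js ws j v rule: less_induct)
  case less
  let ?\<beta> = "boolean_cumulant \<phi>" and ?m = "\<lambda>q. \<phi> (prod_list q)"
  let ?E = "centered_sum (\<lambda>w. \<psi> (prod_list w))"
  note moment = moment_eq_prefix_sum[of \<phi>]
  have one: "\<phi> 1 = 1" using phi by (simp add: unital_functional_def)
  have len: "length js = length ws"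
    using less.prems(1) by (auto simp: alternating_def dest: list_all2_lengthD)
  have mem: "i \<in> I" "u \<in> lists (A i)" "j \<in> I" "v \<in> lists (A j)"
    "list_all2 (\<lambda>j w. j \<in> I \<and> w \<in> lists (A j)) js ws" and suc: "successively (\<noteq>) (i # js @ [j])"
    using less.prems(1) len by (auto simp: alternating_def list_all2_append)
  define C where "C = ?E ws (\<lambda>x. ?m (x @ v))"
  have factor: "?E ws (\<lambda>x. ?m (q @ x @ v)) = ?m q * C" if "q \<in> lists (A i)" for q
    unfolding C_def
  proof (rule centered_sum_moment_factor[OF psi phi cf])
    show "alternating I (\<lambda>j. lists (A j)) (i # js @ [j]) (q # ws @ [v])"
      using that mem suc len by (auto simp: alternating_def list_all2_append)
  qed
  have "prefix_sum (\<lambda>p q. ?E ws (\<lambda>x. ?\<beta> p * ?m (q @ x @ v))) u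
      = prefix_sum (\<lambda>p q. (?\<beta> p * ?m q) * C) u"
    by (rule prefix_sum_cong) (use factor mem in \<open>simp add: centered_sum_mult_left\<close>)
  \<comment> \<open>First block within \<open>u\<close>: the rest factorises as
    \<open>?m q * C\<close>, and the cuts of \<open>u\<close> sum to the moment of
    \<open>u\<close>.\<close>
  then have cut_u: "?E ws (\<lambda>x. prefix_sum (\<lambda>p q. ?\<beta> p * ?m (q @ x @ v)) u) = ?m u * C"
    using one less.prems
    by (simp add: centered_sum_prefix_sum_swap prefix_sum_mult_right moment[symmetric])
  \<comment> \<open>First block ending in a word \<open>w\<close> of \<open>ws\<close>: its cumulant
    involves only the words before \<open>w\<close>, the remaining moment only those after it, and
    the cumulant factor vanishes by induction.\<close>
  have cut_ws: "?E ws (\<lambda>x. prefix_sum (\<lambda>p q. ?\<beta> (u @ p) * ?m (q @ v)) x) = 0"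
  proof (rule centered_sum_prefix_sum_eq_0)
    fix vs w us p q assume ws: "ws = vs @ w # us" and w: "w = p @ q" "p \<noteq> []"
    have "alternating I (\<lambda>j. lists (A j)) js (vs @ w # us)"
      using mem(5) suc ws by (auto simp: alternating_def successively_append_iff successively_Cons)
    then obtain js1 k js2 where split: "js = js1 @ k # js2" "length js1 = length vs" "k \<in> I" "w \<in> lists (A k)"
      "list_all2 (\<lambda>j a. j \<in> I \<and> a \<in> lists (A j)) js1 vs" by (rule alternating_split)
    have "?E vs (\<lambda>x. ?\<beta> (u @ x @ p)) = 0"
    proof (rule less.hyps)
      show "length (concat vs @ p) < length (concat ws @ v)" using ws w less.prems(3) by simp
      show "alternating I (\<lambda>j. lists (A j)) (i # js1 @ [k]) (u # vs @ [p])"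
        using split w mem suc
        by (auto simp: alternating_def list_all2_append successively_append_iff successively_Cons hd_append)
    qed (use less.prems w in auto)
    then show "?E vs (\<lambda>x. ?E us (\<lambda>y. ?\<beta> (u @ x @ p) * ?m ((q @ y) @ v))) = 0"
      by (simp add: centered_sum_mult_left centered_sum_mult_right)
  qed
  \<comment> \<open>First block ending in \<open>v\<close>: by induction only the block that
    exhausts \<open>v\<close> survives, and that is the cumulant in question.\<close>
  have "prefix_sum (\<lambda>p q. ?E ws (\<lambda>x. ?\<beta> (u @ x @ p) * ?m q)) v
      = prefix_sum (\<lambda>p q. if q = [] then ?E ws (\<lambda>x. ?\<beta> (u @ x @ p)) else 0) v"
  proof (rule prefix_sum_cong)
    fix p q assume v: "v = p @ q" "p \<noteq> []"
    have "?E ws (\<lambda>x. ?\<beta> (u @ x @ p)) = 0" if "q \<noteq> []"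
    proof (rule less.hyps)
      show "length (concat ws @ p) < length (concat ws @ v)" using v that by simp
      show "alternating I (\<lambda>j. lists (A j)) (i # js @ [j]) (u # ws @ [p])"
        using v mem suc len by (auto simp: alternating_def list_all2_append)
    qed (use less.prems v in auto)
    then show "?E ws (\<lambda>x. ?\<beta> (u @ x @ p) * ?m q) = (if q = [] then ?E ws (\<lambda>x. ?\<beta> (u @ x @ p)) else 0)"
      using one by (simp add: centered_sum_mult_right)
  qed
  then have cut_v: "?E ws (\<lambda>x. prefix_sum (\<lambda>p q. ?\<beta> (u @ x @ p) * ?m q) v) = ?E ws (\<lambda>x. ?\<beta> (u @ x @ v))"
    using less.prems by (simp add: centered_sum_prefix_sum_swap prefix_sum_top)
  have "?m (u @ x @ v) = prefix_sum (\<lambda>p q. ?\<beta> p * ?m (q @ x @ v)) u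
      + (prefix_sum (\<lambda>p q. ?\<beta> (u @ p) * ?m (q @ v)) x + prefix_sum (\<lambda>p q. ?\<beta> (u @ x @ p) * ?m q) v)" for x
    using moment[OF one, of "u @ x @ v"] less.prems(2)
    by (simp add: prefix_sum_append[of _ u "x @ v"] prefix_sum_append[of _ x v] del: prod_list.append)
  then have "?E ws (\<lambda>x. ?m (u @ x @ v)) = ?m u * C + (0 + ?E ws (\<lambda>x. ?\<beta> (u @ x @ v)))"
    by (simp only: centered_sum_add cut_u cut_ws cut_v)
  then show ?case using factor[OF mem(2)] by simp
qed

section \<open>The contribution of the blocks that wrap around\<close>

definition wrapping_sum :: "('a::complex_algebra_1 \<Rightarrow> complex) \<Rightarrow> 'a list \<Rightarrow> complex" where
  "wrapping_sum \<phi> = prefix_sum (\<lambda>p y. suffix_sum (\<lambda>q r. boolean_cumulant \<phi> (r @ p) * \<phi> (prod_list q)) y)"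

lemma successively_rotate:
  assumes "successively P (xs @ ys)" "P (last (xs @ ys)) (hd (xs @ ys))"
  shows "successively P (ys @ xs)"
  using assms by (cases "xs = []"; cases "ys = []") (auto simp: successively_append_iff)

text \<open>Let \<open>w\<close> be the word in which the initial part ends. The wrapping block
  starts either in the rest of \<open>w\<close> or in a later word. Read from its start across the
  seam, it is an alternating sequence with nonempty ends and centered middle words, so
  \<open>boolean_cumulant_centered_eq_0\<close> applies in both cases.\<close>

lemma centered_sum_wrapping_sum_eq_0:
  assumes psi: "unital_functional \<psi>" and phi: "unital_functional \<phi>"
    and cf: "conditionally_free \<psi> \<phi> I A"
    and alt: "cyclically_alternating I (\<lambda>j. lists (A j)) js ws"
  shows "centered_sum (\<lambda>w. \<psi> (prod_list w)) ws (wrapping_sum \<phi>) = 0"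
  unfolding wrapping_sum_def
proof (rule centered_sum_prefix_sum_eq_0)
  let ?\<beta> = "boolean_cumulant \<phi>" and ?m = "\<lambda>q. \<phi> (prod_list q)"
  let ?E = "centered_sum (\<lambda>w. \<psi> (prod_list w))"
  let ?mem = "list_all2 (\<lambda>j a. j \<in> I \<and> a \<in> lists (A j))"
  note van = boolean_cumulant_centered_eq_0[OF psi phi cf]
  have suc: "successively (\<noteq>) js" and lh: "last js \<noteq> hd js"
    using alt by (auto simp: cyclically_alternating_def alternating_def)
  fix vs w us p q assume ws: "ws = vs @ w # us" and w: "w = p @ q" "p \<noteq> []"
  have "alternating I (\<lambda>j. lists (A j)) js (vs @ w # us)"
    using alt ws by (simp add: cyclically_alternating_def)
  then obtain js1 k js2 where js: "js = js1 @ k # js2" "length js1 = length vs" "k \<in> I" "w \<in> lists (A k)"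
    "?mem js1 vs" "?mem js2 us" by (rule alternating_split)
  \<comment> \<open>The block starts and ends in \<open>w\<close>, and its middle consists of all
    the other words, in the order \<open>us @ vs\<close>.\<close>
  have same: "?E vs (\<lambda>x. ?E us (\<lambda>y. ?\<beta> ((r @ y) @ x @ p))) = 0" if "q = q' @ r" "r \<noteq> []" for q' r
  proof -
    have s1: "successively (\<noteq>) (k # js2 @ js1)"
      using successively_rotate[of "(\<noteq>)" js1 "k # js2"] suc lh js(1) by simp
    have s2: "successively (\<noteq>) (js2 @ js1 @ [k])"
      using successively_rotate[of "(\<noteq>)" "js1 @ [k]" js2] suc lh js(1) by simp
    \<comment> \<open>Some other word has to separate the two pieces of \<open>w\<close>, which
      carry the same index; \<open>last js \<noteq> hd js\<close> provides it.\<close>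
    have "js2 @ js1 \<noteq> []" using lh js(1) by auto
    then have "successively (\<noteq>) (k # (js2 @ js1) @ [k])"
      using s1 s2 by (auto simp: successively_Cons hd_append split: if_splits)
    then have "?E (us @ vs) (\<lambda>z. ?\<beta> (r @ z @ p)) = 0"
      using js w that
      by (intro van[of k "js2 @ js1" k]) (auto simp: alternating_def intro!: list_all2_appendI)
    then show ?thesis
      by (simp add: centered_sum_append centered_sum_swap[of _ vs])
  qed
  have "suffix_sum (\<lambda>q' r. ?E vs (\<lambda>x. ?E us (\<lambda>y. ?\<beta> ((r @ y) @ x @ p) * ?m q'))) q
      = suffix_sum (\<lambda>q' r. 0) q"
    by (rule suffix_sum_cong) (use same in \<open>simp add: centered_sum_mult_right\<close>)
  then have 1: "?E vs (\<lambda>x. ?E us (\<lambda>y. suffix_sum (\<lambda>q' r. ?\<beta> ((r @ y) @ x @ p) * ?m q') q)) = 0"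
    by (simp add: centered_sum_suffix_sum_swap)
  \<comment> \<open>The block starts in a later word \<open>w'\<close>. The words between
    \<open>w\<close> and \<open>w'\<close> enter only the moment, so the cumulant with middle words
    \<open>us2 @ vs\<close> splits off as a factor.\<close>
  have "?E us (suffix_sum (\<lambda>q' r. ?E vs (\<lambda>x. ?\<beta> (r @ x @ p)) * ?m (q @ q'))) = 0"
  proof (rule centered_sum_suffix_sum_eq_0)
    fix us1 w' us2 q' r assume us: "us = us1 @ w' # us2" and w': "w' = q' @ r" "r \<noteq> []"
    have "alternating I (\<lambda>j. lists (A j)) js2 (us1 @ w' # us2)"
      using js us suc by (auto simp: alternating_def successively_append_iff successively_Cons)
    then obtain js3 k' js4 where js2: "js2 = js3 @ k' # js4" "length js3 = length us1" "k' \<in> I"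
      "w' \<in> lists (A k')" "?mem js3 us1" "?mem js4 us2" by (rule alternating_split)
    have "successively (\<noteq>) ((k' # js4 @ js1 @ [k]) @ js3)"
      using successively_rotate[of "(\<noteq>)" "js1 @ [k] @ js3" "k' # js4"] suc lh js(1) js2(1) by simp
    then have "successively (\<noteq>) (k' # (js4 @ js1) @ [k])"
      unfolding successively_append_iff by simp
    then have "?E (us2 @ vs) (\<lambda>z. ?\<beta> (r @ z @ p)) = 0"
      using js js2 w w'
      by (intro van[of k' "js4 @ js1" k]) (auto simp: alternating_def intro!: list_all2_appendI)
    then show "?E us1 (\<lambda>y. ?E us2 (\<lambda>z. ?E vs (\<lambda>x. ?\<beta> ((r @ z) @ x @ p)) * ?m (q @ y @ q'))) = 0"
      by (simp add: centered_sum_mult_right centered_sum_append)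
  qed
  then have 2: "?E vs (\<lambda>x. ?E us (\<lambda>y. suffix_sum (\<lambda>q' r. ?\<beta> (r @ x @ p) * ?m (q @ q')) y)) = 0"
    by (subst centered_sum_swap) (simp add: centered_sum_suffix_sum_swap centered_sum_mult_right)
  show "?E vs (\<lambda>x. ?E us (\<lambda>y. suffix_sum (\<lambda>q' r. ?\<beta> (r @ x @ p) * ?m q') (q @ y))) = 0"
    using 1 2 by (simp add: suffix_sum_append centered_sum_add)
qed

section \<open>The cyclic functional on words\<close>

lemma sorted_wrt_less_le_last: "sorted_wrt (<) ks \<Longrightarrow> k \<in> set ks \<Longrightarrow> k \<le> last ks"
  for ks :: "nat list"
  by (induction ks) (auto simp: less_imp_le dest: last_in_set)

text \<open>Splitting off the first step of a chain gives the recursion assumed for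
  \<open>g\<close>. With cumulants of intervals as \<open>f\<close> and moments of intervals as
  \<open>g\<close>, it sums all ways to fill the gap between the first and the last starting
  position of a cyclic partition.\<close>

lemma sum_chains:
  fixes f :: "nat \<Rightarrow> nat \<Rightarrow> complex"
  defines "S i j \<equiv> {ks. ks \<noteq> [] \<and> sorted_wrt (<) ks \<and> hd ks = i \<and> last ks = j}"
  assumes g: "\<And>j. g j j = 1" "\<And>i j. i < j \<Longrightarrow> j < n \<Longrightarrow> g i j = (\<Sum>k\<in>{i<..j}. f i k * g k j)"
    and "i \<le> j" "j < n"
  shows "finite (S i j) \<and> (\<Sum>ks\<in>S i j. \<Prod>k<length ks - 1. f (ks ! k) (ks ! Suc k)) = g i j"
  using \<open>i \<le> j\<close>
proof (induction "j - i" arbitrary: i rule: less_induct)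
  case less
  show ?case
  proof (cases "i = j")
    case True
    have "ks = [j]" if "ks \<in> S j j" for ks
    proof (cases ks)
      case (Cons k ks')
      then show ?thesis using that last_in_set[of ks'] by (cases "ks' = []") (auto simp: S_def)
    qed (use that in \<open>simp add: S_def\<close>)
    then have "S j j = {[j]}" by (auto simp: S_def)
    then show ?thesis using True g by simp
  next
    case False
    with less.prems have "i < j" by simp
    have S: "S i j = (\<Union>k\<in>{i<..j}. (#) i ` S k j)"
    proof (intro equalityI subsetI)
      fix ks assume ks: "ks \<in> S i j"
      then obtain ks' where ks': "ks = i # ks'" by (cases ks) (auto simp: S_def)
      have ne: "ks' \<noteq> []" using ks False by (auto simp: S_def ks')
      then have "i < hd ks'" using ks by (cases ks') (auto simp: S_def ks')
      moreover have "hd ks' \<le> last ks'"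
        using ks ne sorted_wrt_less_le_last[of ks' "hd ks'"] by (simp add: S_def ks')
      ultimately show "ks \<in> (\<Union>k\<in>{i<..j}. (#) i ` S k j)"
        using ks ne by (auto simp: S_def ks' intro!: bexI[of _ "hd ks'"])
    next
      fix ks assume "ks \<in> (\<Union>k\<in>{i<..j}. (#) i ` S k j)"
      then obtain k ks' where k: "k \<in> {i<..j}" "ks' \<in> S k j" "ks = i # ks'" by blast
      then show "ks \<in> S i j" by (cases ks') (auto simp: S_def)
    qed
    have IH: "finite (S k j)" "(\<Sum>ks\<in>S k j. \<Prod>k<length ks - 1. f (ks ! k) (ks ! Suc k)) = g k j"
      if "k \<in> {i<..j}" for k
      using less.hyps[of k] that by auto
    have cons: "(\<Prod>m<length (i # ks) - 1. f ((i # ks) ! m) ((i # ks) ! Suc m))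
        = f i k * (\<Prod>m<length ks - 1. f (ks ! m) (ks ! Suc m))" if ks: "ks \<in> S k j" for k ks
    proof -
      obtain ks' where "ks = k # ks'" using ks by (cases ks) (auto simp: S_def)
      then show ?thesis by (simp add: prod.lessThan_Suc_shift del: prod.lessThan_Suc)
    qed
    have "(\<Sum>ks\<in>S i j. \<Prod>k<length ks - 1. f (ks ! k) (ks ! Suc k))
        = (\<Sum>k\<in>{i<..j}. \<Sum>ks\<in>(#) i ` S k j. \<Prod>k<length ks - 1. f (ks ! k) (ks ! Suc k))"
      unfolding S
    proof (rule sum.UNION_disjoint)
      show "\<forall>k\<in>{i<..j}. finite ((#) i ` S k j)" using IH by blast
      show "\<forall>k\<in>{i<..j}. \<forall>k'\<in>{i<..j}. k \<noteq> k' \<longrightarrow> (#) i ` S k j \<inter> (#) i ` S k' j = {}"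
        by (auto simp: S_def)
    qed simp
    also have "\<dots> = (\<Sum>k\<in>{i<..j}. f i k * g k j)"
    proof (rule sum.cong[OF refl])
      fix k assume k: "k \<in> {i<..j}"
      have "(\<Sum>ks\<in>(#) i ` S k j. \<Prod>k<length ks - 1. f (ks ! k) (ks ! Suc k))
          = (\<Sum>ks\<in>S k j. f i k * (\<Prod>m<length ks - 1. f (ks ! m) (ks ! Suc m)))"
        by (subst sum.reindex) (simp_all only: inj_on_def list.inject o_def cons cong: sum.cong, simp)
      then show "(\<Sum>ks\<in>(#) i ` S k j. \<Prod>k<length ks - 1. f (ks ! k) (ks ! Suc k)) = f i k * g k j"
        using IH[OF k] by (simp add: sum_distrib_left[symmetric])
    qed
    also have "\<dots> = g i j" using g(2) \<open>i < j\<close> \<open>j < n\<close> by simp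
    finally show ?thesis using IH by (simp add: S)
  qed
qed

section \<open>Cyclic partitions sorted by the block at the seam\<close>

lemma map_nth_interval: "j \<le> length as \<Longrightarrow> map ((!) as) [i..<j] = take (j - i) (drop i as)"
  by (rule nth_equalityI) auto

text \<open>All blocks but the last are ordinary intervals. The last one runs from
  \<open>last ks\<close> to \<open>hd ks + length as\<close>; splitting this range at
  \<open>length as\<close> yields its two pieces.\<close>

lemma prod_cyclic_blocks:
  assumes ks: "ks \<noteq> []" "sorted_wrt (<) ks" "set ks \<subseteq> {..<length as}"
  shows "(\<Prod>k<length ks. h (cyclic_block as ks k))
    = (\<Prod>k<length ks - 1. h (map ((!) as) [ks ! k..<ks ! Suc k]))
      * h (drop (last ks) as @ take (hd ks) as)"
proof -
  have lt: "ks ! k < length as" if "k < length ks" for k using ks(3) nth_mem[OF that] by auto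
  have inner: "cyclic_block as ks k = map ((!) as) [ks ! k..<ks ! Suc k]" if "k < length ks - 1" for k
  proof -
    have "Suc k < length ks" using that by simp
    then show ?thesis using lt[of "Suc k"]
      by (auto simp: cyclic_block_def Let_def nth_append)
  qed
  have hd: "hd ks < length as" "last ks < length as"
    using ks(3) hd_in_set[OF ks(1)] last_in_set[OF ks(1)] by auto
  let ?n = "length as"
  have "cyclic_block as ks (length ks - 1) = map (\<lambda>m. as ! (m mod ?n)) [last ks..<hd ks + ?n]"
    using ks(1) by (simp add: cyclic_block_def Let_def nth_append last_conv_nth)
  also have "[last ks..<hd ks + ?n] = [last ks..<?n] @ [?n..<hd ks + ?n]"
    using hd upt_add_eq_append[of "last ks" ?n "hd ks"] by (simp add: add.commute)
  also have "map (\<lambda>m. as ! (m mod ?n)) \<dots> = drop (last ks) as @ take (hd ks) as"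
    using hd by (auto intro!: nth_equalityI simp: nth_append)
  finally have outer: "cyclic_block as ks (length ks - 1) = drop (last ks) as @ take (hd ks) as" .
  have "{..<length ks} = insert (length ks - 1) {..<length ks - 1}" using ks(1) by auto
  then show ?thesis using inner outer by (simp add: mult.commute)
qed

lemma wrapping_sum_conv_sum:
  "wrapping_sum \<phi> as = (\<Sum>i=1..<length as. \<Sum>j\<in>{i..<length as}.
     boolean_cumulant \<phi> (drop j as @ take i as) * \<phi> (prod_list (map ((!) as) [i..<j])))"
proof -
  let ?n = "length as"
  let ?T = "\<lambda>i j. boolean_cumulant \<phi> (drop j as @ take i as) * \<phi> (prod_list (map ((!) as) [i..<j]))"
  have "suffix_sum (\<lambda>q r. boolean_cumulant \<phi> (r @ take i as) * \<phi> (prod_list q)) (drop i as)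
      = (\<Sum>j\<in>{i..<?n}. ?T i j)" for i
  proof -
    have "(\<Sum>j\<in>{i..<?n}. ?T i j) = (\<Sum>k<?n - i. ?T i (i + k))"
      by (rule sum.reindex_bij_witness[of _ "\<lambda>k. i + k" "\<lambda>j. j - i"]) auto
    also have "\<dots> = suffix_sum (\<lambda>q r. boolean_cumulant \<phi> (r @ take i as) * \<phi> (prod_list q)) (drop i as)"
      unfolding suffix_sum_conv_sum length_drop
      by (rule sum.cong) (auto simp: map_nth_interval add.commute)
    finally show ?thesis ..
  qed
  then have "wrapping_sum \<phi> as = (\<Sum>i=1..?n. \<Sum>j\<in>{i..<?n}. ?T i j)"
    by (simp add: wrapping_sum_def prefix_sum_conv_sum)
  \<comment> \<open>For \<open>i = ?n\<close> nothing is left for the nonempty final part, so the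
    inner sum is empty.\<close>
  also have "\<dots> = (\<Sum>i=1..<?n. \<Sum>j\<in>{i..<?n}. ?T i j)"
    by (rule sum.mono_neutral_right) auto
  finally show ?thesis .
qed

text \<open>Fix the first starting position \<open>i\<close> and the last one \<open>j\<close>. The
  last block then depends on \<open>i\<close> and \<open>j\<close> alone, and by
  \<open>sum_chains\<close> the blocks between them sum to the moment of the positions from
  \<open>i\<close> to \<open>j - 1\<close>.\<close>

lemma cyclic_value_eq:
  assumes one: "\<phi> 1 = 1" and as: "as \<noteq> []"
  shows "cyclic_value \<phi> as = \<phi> (prod_list as) + wrapping_sum \<phi> as"
proof -
  let ?n = "length as" and ?\<beta> = "boolean_cumulant \<phi>"
  define f where "f i j = ?\<beta> (map ((!) as) [i..<j])" for i j
  define g where "g i j = \<phi> (prod_list (map ((!) as) [i..<j]))" for i j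
  define h where "h i j = ?\<beta> (drop j as @ take i as)" for i j
  define c where "c ks = (\<Prod>k<length ks - 1. f (ks ! k) (ks ! Suc k))" for ks
  define K where "K = {ks. ks \<noteq> [] \<and> sorted_wrt (<) ks \<and> set ks \<subseteq> {..<?n}}"
  define S where "S i j = {ks. ks \<noteq> [] \<and> sorted_wrt (<) ks \<and> hd ks = i \<and> last ks = j}" for i j :: nat
  have len: "length ks \<le> ?n" if "ks \<in> K" for ks
  proof -
    have "distinct ks" using that by (simp add: K_def strict_sorted_iff)
    then have "length ks = card (set ks)" by (simp add: distinct_card)
    also have "\<dots> \<le> card {..<?n}" using that by (intro card_mono) (auto simp: K_def)
    finally show ?thesis by simp
  qed
  have finK: "finite K"
    by (rule finite_subset[OF _ finite_lists_length_le[of "{..<?n}" ?n]])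
      (use len in \<open>auto simp: K_def\<close>)
  have "cyclic_value \<phi> as = (\<Sum>l=1..?n. \<Sum>ks\<in>{ks\<in>K. length ks = l}. \<Prod>k<length ks. ?\<beta> (cyclic_block as ks k))"
    using as unfolding cyclic_value_def by (auto intro!: sum.cong simp: K_def)
  also have "\<dots> = (\<Sum>ks\<in>K. \<Prod>k<length ks. ?\<beta> (cyclic_block as ks k))"
  proof (rule sum.group[OF finK])
    show "length ` K \<subseteq> {1..?n}" using len by (auto simp: K_def Suc_le_eq)
  qed simp
  also have "\<dots> = (\<Sum>ks\<in>K. c ks * h (hd ks) (last ks))"
    by (rule sum.cong) (simp_all add: K_def c_def f_def h_def prod_cyclic_blocks)
  also have "\<dots> = (\<Sum>(i, j)\<in>(SIGMA i:{..<?n}. {i..<?n}). \<Sum>ks\<in>{ks\<in>K. (hd ks, last ks) = (i, j)}. c ks * h (hd ks) (last ks))"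
  proof -
    have hl: "hd ks \<le> last ks" if "ks \<in> K" for ks
      using that sorted_wrt_less_le_last[of ks "hd ks"] by (simp add: K_def)
    have "(\<lambda>ks. (hd ks, last ks)) ` K \<subseteq> (SIGMA i:{..<?n}. {i..<?n})"
      using hl by (auto simp: K_def subset_iff)
    from sum.group[OF finK _ this, of "\<lambda>ks. c ks * h (hd ks) (last ks)"]
    show ?thesis by (simp only: case_prod_unfold prod.collapse) simp
  qed
  also have "\<dots> = (\<Sum>i<?n. \<Sum>j\<in>{i..<?n}. \<Sum>ks\<in>{ks\<in>K. (hd ks, last ks) = (i, j)}. c ks * h (hd ks) (last ks))"
    by (rule sum.Sigma[symmetric]) auto
  also have "\<dots> = (\<Sum>i<?n. \<Sum>j\<in>{i..<?n}. h i j * g i j)"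
  proof (intro sum.cong refl)
    fix i j assume ij: "i \<in> {..<?n}" "j \<in> {i..<?n}"
    \<comment> \<open>A strictly increasing list whose last entry is below \<open>?n\<close> stays
      below \<open>?n\<close> altogether.\<close>
    have Sij: "{ks\<in>K. (hd ks, last ks) = (i, j)} = S i j"
      using ij sorted_wrt_less_le_last by (fastforce simp: K_def S_def)
    have rec: "g i j = (\<Sum>k\<in>{i<..j}. f i k * g k j)" if "i < j" "j < ?n" for i j
    proof -
      let ?w = "map ((!) as) [i..<j]"
      have "g i j = prefix_sum (\<lambda>p q. ?\<beta> p * \<phi> (prod_list q)) ?w"
        unfolding g_def using one that by (intro moment_eq_prefix_sum) auto
      also have "\<dots> = (\<Sum>k=1..j - i. f i (i + k) * g (i + k) j)"
        by (auto simp: prefix_sum_conv_sum f_def g_def take_map drop_map intro!: sum.cong)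
      also have "\<dots> = (\<Sum>k\<in>{i<..j}. f i k * g k j)"
        by (rule sum.reindex_bij_witness[of _ "\<lambda>k. k - i" "\<lambda>k. i + k"]) auto
      finally show ?thesis .
    qed
    have "(\<Sum>ks\<in>S i j. c ks) = g i j"
      using sum_chains[of g ?n f i j] rec one ij by (simp add: S_def c_def g_def)
    then have "(\<Sum>ks\<in>S i j. c ks * h (hd ks) (last ks)) = h i j * g i j"
      by (simp add: S_def sum_distrib_right[symmetric] mult.commute)
    then show "(\<Sum>ks\<in>{ks\<in>K. (hd ks, last ks) = (i, j)}. c ks * h (hd ks) (last ks)) = h i j * g i j"
      by (simp only: Sij)
  qed
  \<comment> \<open>For \<open>i = 0\<close> the last block stops at the seam, and the sum over
    \<open>j\<close> is the last-block expansion of the moment; the terms with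
    \<open>i \<ge> 1\<close> wrap around.\<close>
  also have "\<dots> = (\<Sum>j<?n. h 0 j * g 0 j) + (\<Sum>i=1..<?n. \<Sum>j\<in>{i..<?n}. h i j * g i j)"
    using as by (simp add: lessThan_atLeast0 sum.atLeast_Suc_lessThan)
  also have "(\<Sum>j<?n. h 0 j * g 0 j) = suffix_sum (\<lambda>q r. \<phi> (prod_list q) * ?\<beta> r) as"
    by (auto simp: suffix_sum_conv_sum h_def g_def map_nth_interval mult.commute intro!: sum.cong)
  also have "\<dots> = \<phi> (prod_list as)" using moment_eq_suffix_sum[of \<phi> as] one as by simp
  finally show ?thesis by (simp add: wrapping_sum_conv_sum h_def g_def)
qed

text \<open>Sorted by the block of \<open>a\<close>, both sides consist of the same four sums, with
  blocks \<open>[a]\<close>, \<open>a # p\<close>, \<open>r @ [a]\<close> and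
  \<open>r @ a # p\<close> for nonempty \<open>p\<close> and \<open>r\<close>. Moving
  \<open>a\<close> across the seam only exchanges whether the second and third kinds count as
  ordinary or as wrapping.\<close>

lemma cyclic_value_rotate1:
  assumes one: "\<phi> 1 = 1"
  shows "cyclic_value \<phi> (a # as) = cyclic_value \<phi> (as @ [a])"
proof -
  let ?\<beta> = "boolean_cumulant \<phi>" and ?m = "\<lambda>q. \<phi> (prod_list q)"
  have "?m (a # as) = ?\<beta> [a] * ?m as + prefix_sum (\<lambda>p q. ?\<beta> (a # p) * ?m q) as"
    using moment_eq_prefix_sum[of \<phi> "a # as"] one by simp
  moreover have "?m (as @ [a]) = suffix_sum (\<lambda>q r. ?m q * ?\<beta> (r @ [a])) as + ?m as * ?\<beta> [a]"
    using moment_eq_suffix_sum[of \<phi> "as @ [a]"] one by (simp add: suffix_sum_append)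
  moreover have "wrapping_sum \<phi> (a # as) = suffix_sum (\<lambda>q r. ?m q * ?\<beta> (r @ [a])) as
      + prefix_sum (\<lambda>p y. suffix_sum (\<lambda>q r. ?\<beta> (r @ a # p) * ?m q) y) as"
    by (simp add: wrapping_sum_def mult.commute)
  moreover have "wrapping_sum \<phi> (as @ [a]) = prefix_sum (\<lambda>p q. ?\<beta> (a # p) * ?m q) as
      + prefix_sum (\<lambda>p y. suffix_sum (\<lambda>q r. ?\<beta> (r @ a # p) * ?m q) y) as"
    by (simp add: wrapping_sum_def prefix_sum_append suffix_sum_append prefix_sum_add)
  ultimately show ?thesis by (simp add: cyclic_value_eq[of \<phi>, OF one] mult.commute)
qed

lemma cyclic_value_append_commute:
  assumes "\<phi> 1 = 1"
  shows "cyclic_value \<phi> (as @ bs) = cyclic_value \<phi> (bs @ as)"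
proof (induction as arbitrary: bs)
  case (Cons a as)
  show ?case
    using Cons[of "bs @ [a]"] cyclic_value_rotate1[of \<phi> a "as @ bs"] assms by simp
qed simp

section \<open>The tensor algebra\<close>

lemma linear_functional_mult_both:
  "linear_functional f \<Longrightarrow> linear_functional (\<lambda>t. f (x * t * y))"
  by (simp add: linear_functional_iff distrib_left distrib_right mult_scaleC_left mult_scaleC_right)

lemma linear_functional_span_eq_0:
  assumes f: "linear_functional f" and "\<And>s. s \<in> S \<Longrightarrow> f s = 0" and "t \<in> complex_vec.span S"
  shows "f t = 0"
  using assms(3)
proof (induction rule: complex_vec.span_induct)
  show "complex_vec.subspace {t. f t = 0}"
    using f by (auto simp: complex_vec.subspace_def linear_functional_zero linear_functional_arith)
qed (use assms in auto)

text \<open>Factors are replaced by generators from left to right; \<open>x\<close> collects those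
  already replaced.\<close>

lemma linear_functional_prod_span_eq_0:
  assumes "linear_functional f" and "list_all2 (\<lambda>j t. t \<in> complex_vec.span (S j)) js ts"
    and "\<And>ss. list_all2 (\<lambda>j s. s \<in> S j) js ss \<Longrightarrow> f (x * prod_list ss) = 0"
  shows "f (x * prod_list ts) = 0"
  using assms(2,3)
proof (induction js ts arbitrary: x rule: list_all2_induct)
  case (Cons j js t ts)
  have "f (x * t * prod_list ts) = 0"
  proof (rule linear_functional_span_eq_0[where f = "\<lambda>t. f (x * t * prod_list ts)"])
    fix s assume s: "s \<in> S j"
    show "f (x * s * prod_list ts) = 0"
    proof (rule Cons.IH)
      fix ss assume "list_all2 (\<lambda>j s. s \<in> S j) js ss"
      with s show "f (x * s * prod_list ss) = 0" using Cons.prems[of "s # ss"] by (simp add: mult.assoc)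
    qed
  qed (use assms(1) Cons.hyps in \<open>auto intro: linear_functional_mult_both\<close>)
  then show ?case by (simp add: mult.assoc)
qed simp

text \<open>For centered \<open>t\<close> the left side is \<open>t\<close> itself, so centered
  elements are combinations of words minus their expectations. Centering is linear in
  \<open>t\<close>, which leaves only pure tensors to check.\<close>

lemma tensor_algebra_of_center:
  assumes psi: "linear_functional \<psi>" and t: "t \<in> tensor_algebra_of S"
  shows "t - tensor_extension \<psi> t *\<^sub>C 1
    \<in> complex_vec.span {pure_tensor w - \<psi> (prod_list w) *\<^sub>C 1 |w. w \<in> lists S}"
  using t unfolding tensor_algebra_of_def
proof (induction rule: complex_vec.span_induct)
  let ?c = "\<lambda>t. t - tensor_extension \<psi> t *\<^sub>C 1"
  let ?U = "complex_vec.span {pure_tensor w - \<psi> (prod_list w) *\<^sub>C 1 |w. w \<in> lists S}"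
  note lin = tensor_extension(1)[OF psi]
  have c: "?c (s + t) = ?c s + ?c t" "?c (c *\<^sub>C t) = c *\<^sub>C ?c t" "?c 0 = 0" for s t c
    by (simp_all add: linear_functional_arith[OF lin] linear_functional_zero[OF lin]
        scaleC_add_left complex_vec.scale_right_diff_distrib scaleC_scaleC)
  show "complex_vec.subspace {t. ?c t \<in> ?U}"
    unfolding complex_vec.subspace_def mem_Collect_eq c
    by (blast intro: complex_vec.span_add complex_vec.span_scale complex_vec.span_zero)
  fix t assume "t \<in> {pure_tensor as |as. set as \<subseteq> S}"
  then show "?c t \<in> ?U"
    by (auto simp: tensor_extension(2)[OF psi] intro!: complex_vec.span_base)
qed

lemma unital_subalgebra_tensor_algebra_of: "unital_subalgebra (tensor_algebra_of S)"
proof -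
  let ?G = "{pure_tensor as |as. set as \<subseteq> S}"
  have "s * t \<in> complex_vec.span ?G" if "s \<in> complex_vec.span ?G" "t \<in> complex_vec.span ?G" for s t
    using that(1)
  proof (induction rule: complex_vec.span_induct)
    show "complex_vec.subspace {s. s * t \<in> complex_vec.span ?G}"
      by (simp add: complex_vec.subspace_def distrib_right mult_scaleC_left
          complex_vec.span_add complex_vec.span_scale complex_vec.span_zero)
    fix s assume "s \<in> ?G"
    then obtain as where s: "s = pure_tensor as" "set as \<subseteq> S" by blast
    show "s * t \<in> complex_vec.span ?G"
      using that(2)
    proof (induction rule: complex_vec.span_induct)
      show "complex_vec.subspace {t. s * t \<in> complex_vec.span ?G}"
        by (simp add: complex_vec.subspace_def distrib_left mult_scaleC_right
            complex_vec.span_add complex_vec.span_scale complex_vec.span_zero)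
      fix t assume "t \<in> ?G"
      then obtain bs where "t = pure_tensor bs" "set bs \<subseteq> S" by blast
      then have "s * t = pure_tensor (as @ bs)" "set (as @ bs) \<subseteq> S"
        using s by (auto simp: pure_tensor_append)
      then show "s * t \<in> complex_vec.span ?G" by (blast intro: complex_vec.span_base)
    qed
  qed
  moreover have "pure_tensor [] \<in> complex_vec.span ?G" by (rule complex_vec.span_base) force
  ultimately show ?thesis
    by (simp add: unital_subalgebra_def tensor_algebra_of_def pure_tensor_Nil)
qed

lemma tensor_extension_one: "unital_functional f \<Longrightarrow> tensor_extension f 1 = 1"
  using tensor_extension(2)[of f "[]"] by (simp add: pure_tensor_Nil unital_functional_def)

lemma unital_functional_tensor_extension: "unital_functional f \<Longrightarrow> unital_functional (tensor_extension f)"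
  using tensor_extension(1)[of f] tensor_extension_one[of f] by (simp add: unital_functional_def)

text \<open>Tensor extensions factor through the multiplication map from the tensor algebra to the
  algebra; \<open>collapses t a\<close> says that this map sends \<open>t\<close> to \<open>a\<close>, as far as functionals can see.\<close>

definition collapses :: "'a::complex_algebra_1 tensor_algebra \<Rightarrow> 'a \<Rightarrow> bool" where
  "collapses t a \<longleftrightarrow> (\<forall>f x y. linear_functional f \<longrightarrow>
     tensor_extension f (x * t * y) = tensor_extension f (x * pure_tensor [a] * y))"

lemma collapses_add: "collapses s a \<Longrightarrow> collapses t b \<Longrightarrow> collapses (s + t) (a + b)"
  using pure_tensor_add[of 0 "[a]" a b]
  by (simp add: collapses_def distrib_left distrib_right linear_functional_arith[OF tensor_extension(1)])

lemma collapses_scale: "collapses t a \<Longrightarrow> collapses (c *\<^sub>C t) (c *\<^sub>C a)"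
  using pure_tensor_scale[of 0 "[a]" c a]
  by (simp add: collapses_def mult_scaleC_left mult_scaleC_right linear_functional_arith[OF tensor_extension(1)])

lemma tensor_functional_eqI:
  assumes f: "linear_functional f" and g: "linear_functional g"
    and eq: "\<And>w. f (pure_tensor w) = g (pure_tensor w)"
  shows "f t = g t"
  by (induction t rule: tensor_algebra_induct)
    (simp_all add: eq linear_functional_arith[OF f] linear_functional_arith[OF g]
      linear_functional_zero[OF f] linear_functional_zero[OF g])

text \<open>By linearity \<open>x\<close> and \<open>y\<close> may be taken to be pure tensors, and
  then both sides are \<open>f\<close> of the same product.\<close>

lemma collapses_pure_tensor: "collapses (pure_tensor w) (prod_list w)"
  unfolding collapses_def
proof (intro allI impI)
  fix f :: "'a \<Rightarrow> complex" and x y :: "'a tensor_algebra"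
  assume f: "linear_functional f"
  note lin = tensor_extension(1)[OF f]
  have both: "linear_functional (\<lambda>x. tensor_extension f (x * (t * y)))" for t y
    using linear_functional_mult_both[OF lin, of 1 "t * y"] by simp
  have "tensor_extension f (pure_tensor v * pure_tensor w * y)
      = tensor_extension f (pure_tensor v * pure_tensor [prod_list w] * y)" for v
  proof (rule tensor_functional_eqI[of "\<lambda>y. tensor_extension f (pure_tensor v * pure_tensor w * y)"
        "\<lambda>y. tensor_extension f (pure_tensor v * pure_tensor [prod_list w] * y)"])
    show "tensor_extension f (pure_tensor v * pure_tensor w * pure_tensor z)
        = tensor_extension f (pure_tensor v * pure_tensor [prod_list w] * pure_tensor z)" for z
      by (simp flip: pure_tensor_append add: tensor_extension(2)[OF f] mult.assoc)
  qed (use linear_functional_mult_both[OF lin, of _ 1] in simp_all)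
  then have "tensor_extension f (pure_tensor v * (pure_tensor w * y))
      = tensor_extension f (pure_tensor v * (pure_tensor [prod_list w] * y))" for v
    by (simp add: mult.assoc)
  then have "tensor_extension f (x * (pure_tensor w * y)) = tensor_extension f (x * (pure_tensor [prod_list w] * y))"
    by (rule tensor_functional_eqI[OF both both])
  then show "tensor_extension f (x * pure_tensor w * y) = tensor_extension f (x * pure_tensor [prod_list w] * y)"
    by (simp add: mult.assoc)
qed

lemma ex_collapses:
  assumes S: "unital_subalgebra S" and t: "t \<in> tensor_algebra_of S"
  shows "\<exists>a\<in>S. collapses t a"
  using t unfolding tensor_algebra_of_def
proof (induction rule: complex_vec.span_induct)
  have sub: "complex_vec.subspace S" using S by (simp add: unital_subalgebra_def)
  have "collapses 0 0" using collapses_scale[OF collapses_pure_tensor, of 0] by simp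
  then show "complex_vec.subspace {t. \<exists>a\<in>S. collapses t a}"
    using sub collapses_add collapses_scale unfolding complex_vec.subspace_def by blast
qed (use S collapses_pure_tensor unital_subalgebra_prod_list in blast)

lemma tensor_extension_collapses:
  assumes "linear_functional f" "collapses t a"
  shows "tensor_extension f t = f a"
  using assms(2)[unfolded collapses_def, rule_format, OF assms(1), of 1 1] tensor_extension(2)[OF assms(1), of "[a]"]
  by simp

lemma tensor_extension_prod_collapses:
  assumes f: "linear_functional f" and "list_all2 collapses ts as"
  shows "tensor_extension f (x * prod_list ts) = tensor_extension f (x * pure_tensor as)"
  using assms(2)
proof (induction ts as arbitrary: x rule: list_all2_induct)
  case (Cons t ts a as)
  have "tensor_extension f (x * t * prod_list ts) = tensor_extension f (x * pure_tensor [a] * prod_list ts)"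
    using Cons.hyps(1) f by (simp add: collapses_def)
  also have "\<dots> = tensor_extension f (x * pure_tensor [a] * pure_tensor as)" by (rule Cons.IH)
  finally show ?case by (simp add: mult.assoc pure_tensor_append[of "[a]" as, simplified])
qed (simp add: pure_tensor_Nil)

text \<open>Each \<open>t\<close> in the tensor algebra of \<open>A j\<close> collapses to some
  \<open>a\<close> in \<open>A j\<close> with the same expectations. The resulting sequence is again
  alternating and centered, and both extended functionals take the same values on its product, so
  conditional freeness carries over.\<close>

lemma conditionally_free_tensor_algebra:
  assumes psi: "linear_functional \<psi>" and phi: "linear_functional \<phi>"
    and cf: "conditionally_free \<psi> \<phi> I A"
  shows "conditionally_free (tensor_extension \<psi>) (tensor_extension \<phi>) I (\<lambda>i. tensor_algebra_of (A i))"
proof -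
  have "tensor_extension \<psi> (prod_list ts) = 0 \<and>
      tensor_extension \<phi> (prod_list ts) = prod_list (map (tensor_extension \<phi>) ts)"
    if ne: "ts \<noteq> []" and alt: "alternating I (\<lambda>i. tensor_algebra_of (A i)) js ts"
      and cen: "centered (tensor_extension \<psi>) ts" for js ts
  proof -
    have sub: "unital_subalgebra (A i)" if "i \<in> I" for i
      using cf that by (simp add: conditionally_free_def)
    have "list_all2 (\<lambda>j t. j \<in> I \<and> t \<in> tensor_algebra_of (A j)) js ts"
      using alt by (simp add: alternating_def)
    then have "\<exists>as. list_all2 collapses ts as \<and> list_all2 (\<lambda>j a. j \<in> I \<and> a \<in> A j) js as"
    proof (induction js ts rule: list_all2_induct)
      case (Cons j js t ts)
      obtain a where "a \<in> A j" "collapses t a" using ex_collapses[OF sub] Cons.hyps by blast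
      moreover obtain as where "list_all2 collapses ts as" "list_all2 (\<lambda>j a. j \<in> I \<and> a \<in> A j) js as"
        using Cons.IH by blast
      ultimately show ?case by (intro exI[of _ "a # as"]) (use Cons.hyps in simp)
    qed simp
    then obtain as where as: "list_all2 collapses ts as" "list_all2 (\<lambda>j a. j \<in> I \<and> a \<in> A j) js as" by blast
    have map: "map (tensor_extension f) ts = map f as" if "linear_functional f" for f
      using as(1) by (induction ts as rule: list_all2_induct) (simp_all add: tensor_extension_collapses[OF that])
    have prod: "tensor_extension f (prod_list ts) = f (prod_list as)" if "linear_functional f" for f
      using tensor_extension_prod_collapses[OF that as(1), of 1] tensor_extension(2)[OF that] by simp
    have "alternating I A js as" using alt as(2) by (simp add: alternating_def)
    moreover have "\<psi> ` set as = tensor_extension \<psi> ` set ts"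
      using map[OF psi] by (metis list.set_map)
    with cen have "centered \<psi> as" by (fastforce simp: centered_def)
    moreover have "as \<noteq> []" using ne as(1) by auto
    ultimately have "\<psi> (prod_list as) = 0" "\<phi> (prod_list as) = prod_list (map \<phi> as)"
      using cf by (auto simp: conditionally_free_def)
    then show ?thesis by (simp only: prod map psi phi)
  qed
  then show ?thesis
    using unital_subalgebra_tensor_algebra_of unfolding conditionally_free_def by blast
qed

section \<open>Trace property and values of the cyclic functional\<close>

lemma tracial_cyclic_functional:
  assumes phi: "unital_functional \<phi>"
  shows "tracial (cyclic_functional \<phi>)"
  unfolding tracial_def
proof (intro allI)
  fix a b :: "'a tensor_algebra"
  have lin: "linear_functional \<phi>" and one: "\<phi> 1 = 1" using phi by (auto simp: unital_functional_def)
  note cl = cyclic_functional(1)[OF lin]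
  have L: "linear_functional (\<lambda>t. cyclic_functional \<phi> (x * t))" "linear_functional (\<lambda>t. cyclic_functional \<phi> (t * x))" for x
    using linear_functional_mult_both[OF cl, of x 1] linear_functional_mult_both[OF cl, of 1 x] by simp_all
  have "cyclic_functional \<phi> (pure_tensor v * b) = cyclic_functional \<phi> (b * pure_tensor v)" for v
  proof (rule tensor_functional_eqI[OF L])
    fix w
    show "cyclic_functional \<phi> (pure_tensor v * pure_tensor w) = cyclic_functional \<phi> (pure_tensor w * pure_tensor v)"
      unfolding pure_tensor_append[symmetric] cyclic_functional(2)[OF lin]
      using one by (rule cyclic_value_append_commute)
  qed
  then show "cyclic_functional \<phi> (a * b) = cyclic_functional \<phi> (b * a)"
    by (rule tensor_functional_eqI[OF L(2) L(1)])
qed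

text \<open>The difference \<open>F\<close> of the two functionals is linear and equals
  \<open>wrapping_sum \<phi>\<close> on words. Writing the factors as combinations of centered words
  reduces the claim to \<open>centered_sum_wrapping_sum_eq_0\<close>.\<close>

lemma cyclic_functional_centered_prod:
  assumes psi: "unital_functional \<psi>" and phi: "unital_functional \<phi>"
    and cf: "conditionally_free \<psi> \<phi> I A"
    and alt: "cyclically_alternating I (\<lambda>i. tensor_algebra_of (A i)) js ts"
    and cen: "centered (tensor_extension \<psi>) ts"
  shows "cyclic_functional \<phi> (prod_list ts) = tensor_extension \<phi> (prod_list ts)"
proof -
  have lin: "linear_functional \<psi>" "linear_functional \<phi>" and one: "\<phi> 1 = 1"
    using psi phi by (auto simp: unital_functional_def)
  define F where "F t = cyclic_functional \<phi> t - tensor_extension \<phi> t" for t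
  have F: "linear_functional F" unfolding F_def
    by (intro linear_functional_diff cyclic_functional(1) tensor_extension(1) lin)
  \<comment> \<open>On the empty word both functionals are 1 and the wrapping sum is 0.\<close>
  have Fpure: "F (pure_tensor w) = wrapping_sum \<phi> w" for w
    using cyclic_value_eq[of \<phi> w] one
    by (cases "w = []") (simp_all add: F_def cyclic_functional(2)[OF lin(2)] tensor_extension(2)[OF lin(2)]
        cyclic_value_def wrapping_sum_def)
  let ?c = "\<lambda>w. pure_tensor w - \<psi> (prod_list w) *\<^sub>C 1"
  define S where "S j = {?c w |w. w \<in> lists (A j)}" for j
  have mem: "list_all2 (\<lambda>j t. j \<in> I \<and> t \<in> tensor_algebra_of (A j)) js ts"
    using alt by (simp add: cyclically_alternating_def alternating_def)
  have "t \<in> complex_vec.span (S j)" if "t \<in> tensor_algebra_of (A j)" "t \<in> set ts" for t j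
    using tensor_algebra_of_center[OF lin(1) that(1)] cen that(2) by (simp add: centered_def S_def)
  then have spans: "list_all2 (\<lambda>j t. t \<in> complex_vec.span (S j)) js ts"
    using mem by (auto simp: list_all2_conv_all_nth)
  have "F (1 * prod_list ts) = 0"
  proof (rule linear_functional_prod_span_eq_0[OF F spans])
    fix ss assume ss: "list_all2 (\<lambda>j s. s \<in> S j) js ss"
    then have "\<exists>ws. ss = map ?c ws \<and> list_all2 (\<lambda>j w. w \<in> lists (A j)) js ws"
    proof (induction js ss rule: list_all2_induct)
      case (Cons j js s ss)
      then obtain w ws where "s = ?c w" "w \<in> lists (A j)" "ss = map ?c ws"
        "list_all2 (\<lambda>j w. w \<in> lists (A j)) js ws" by (auto simp: S_def)
      then show ?case by (intro exI[of _ "w # ws"]) simp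
    qed simp
    then obtain ws where ws: "ss = map ?c ws" "list_all2 (\<lambda>j w. w \<in> lists (A j)) js ws" by blast
    have "cyclically_alternating I (\<lambda>j. lists (A j)) js ws"
      using alt ws(2) mem by (auto simp: cyclically_alternating_def alternating_def list_all2_conv_all_nth)
    then have "centered_sum (\<lambda>w. \<psi> (prod_list w)) ws (wrapping_sum \<phi>) = 0"
      by (rule centered_sum_wrapping_sum_eq_0[OF psi phi cf])
    then show "F (1 * prod_list ss) = 0"
      using centered_sum_hom[of pure_tensor F "\<lambda>w. \<psi> (prod_list w)" ws 1 1] F
      by (simp add: pure_tensor_Nil pure_tensor_append ws(1) Fpure)
  qed
  then show ?thesis by (simp add: F_def)
qed

theorem theorem1p9:
  fixes \<psi> \<phi> :: "'a::complex_algebra_1 \<Rightarrow> complex"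
    and I :: "'i set" and A :: "'i \<Rightarrow> 'a set"
  assumes "unital_functional \<psi>" and "unital_functional \<phi>"
    and "\<And>i. i \<in> I \<Longrightarrow> unital_subalgebra (A i)"
    and "conditionally_free \<psi> \<phi> I A"
  shows "cyclically_conditionally_free
           (tensor_extension \<psi>) (tensor_extension \<phi>) (cyclic_functional \<phi>)
           I (\<lambda>i. tensor_algebra_of (A i))"
proof -
  have lin: "linear_functional \<psi>" "linear_functional \<phi>"
    using assms by (auto simp: unital_functional_def)
  have unital: "unital_functional (tensor_extension \<psi>)" "unital_functional (tensor_extension \<phi>)"
    using assms by (simp_all add: unital_functional_tensor_extension)
  note cf = conditionally_free_tensor_algebra[OF lin assms(4)]
  \<comment> \<open>On these products the cyclic functional agrees with the extension of
    \<open>\<phi>\<close>, which is multiplicative there by conditional freeness in the tensor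
    algebra.\<close>
  have "cyclic_functional \<phi> (prod_list ts) = prod_list (map (tensor_extension \<phi>) ts)"
    if "cyclically_alternating I (\<lambda>i. tensor_algebra_of (A i)) js ts" "centered (tensor_extension \<psi>) ts"
    for js ts
    using cyclic_functional_centered_prod[OF assms(1,2,4) that] that
      conditionally_free_prod_list[OF unital(2) cf, of js ts]
    by (simp add: cyclically_alternating_def)
  then show ?thesis
    unfolding cyclically_conditionally_free_def
    by (intro conjI allI impI unital cf cyclic_functional(1)[OF lin(2)] tracial_cyclic_functional[OF assms(2)]) blast
qed

end
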